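(* If $\{N_k\}_{k=0}^\infty$ is an arbitrary sequence of positive integers and $s$ is any complex number such that $\mathrm{Re}(s)>-2N_k$ for each integer $k\ge0$, then the alternating Hurwitz zeta function has the exact expansion $$\zeta_E(s,q)=\frac12 q^{-s}+\frac14 s\,q^{-s-1}-2q^{-s}\left(\sum_{k=0}^\infty\sum_{n=1}^{N_k-1}(-1)^{n-1}\frac{(s)_{2n+1}}{((2k+1)\pi)^{2n+2}q^{2n+1}}+\sum_{k=0}^\infty(-1)^{N_k-1}\frac{(s)_{2N_k+1}\,\Pi_{s+2N_k+1}((2k+1)\pi q)}{((2k+1)\pi)^{2N_k+2}q^{2N_k+1}}\right)$$ provided that $|\arg q|<\pi$.
   Context: For $|\arg q|<\pi$ ($q\ne0$), $\zeta_E(s,q)$ denotes the alternating Hurwitz zeta function, defined for $\mathrm{Re}(s)>0$ by $\zeta_E(s,q)=\sum_{n=0}^\infty \frac{(-1)^n}{(n+q)^s}$ (principal branches) and extended to an entire function of $s\in\mathbb C$ by analytic continuation. $(s)_k=s(s+1)\cdots(s+k-1)$ is the Pochhammer symbol, with $(s)_0=1$. Powers $q^{-s}$ are principal values; empty sums are zero. The function $\Pi_p(w)$ is defined by $$\Pi_p(w)=\frac{w^p}{2}\left(e^{\frac{\pi}{2}\mathrm i p}e^{\mathrm i w}\,\Gamma(1-p,we^{\frac{\pi}{2}\mathrm i})+e^{-\frac{\pi}{2}\mathrm i p}e^{-\mathrm i w}\,\Gamma(1-p,we^{-\frac{\pi}{2}\mathrm i})\right),$$ where $\Gamma(a,z)$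 is the (upper) incomplete gamma function, $\Gamma(a,z)=\int_z^\infty t^{a-1}e^{-t}\,dt$ for $|\arg z|<\pi$, continued analytically in $z$ on the Riemann surface of the logarithm (so $we^{\pm\frac{\pi}{2}\mathrm i}$ has argument $\arg w\pm\frac{\pi}{2}$).
   Formalization: For arbitrary N_k the two sums over k can both diverge (e.g. s=q=1, N_k growing fast), so the expansion is proved with both taken together as one convergent sum over k; the displayed form with two separate sums is proved whenever either of them converges. *)

theory Defs
  imports "HOL-Complex_Analysis.Complex_Analysis"
begin

text \<open>The entire function of \<open>s\<close> that continues the alternating
  series, which converges (not always absolutely) for \<open>Re s > 0\<close>; unique by the identity theorem.\<close>

definition alt_hurwitz_zeta :: "complex \<Rightarrow> complex \<Rightarrow> complex" where
  "alt_hurwitz_zeta s q =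
     (THE f. f holomorphic_on UNIV \<and>
        (\<forall>z. Re z > 0 \<longrightarrow> (\<lambda>n. (-1) ^ n / (of_nat n + q) powr z) sums f z)) s"

text \<open>The upper incomplete gamma function on the Riemann surface of the logarithm. A point of
  that surface is given by its logarithm \<open>L\<close>, so that \<open>upper_Gamma_log a L\<close> is
  \<open>\<Gamma>(a, z)\<close> at the point \<open>z = exp L\<close> with argument \<open>Im L\<close>. On the principal sheet
  \<open>\<bar>Im L\<bar> < \<pi>\<close> the path from \<open>z\<close> to \<open>\<infinity>\<close> is the horizontal ray \<open>z + u\<close>, \<open>u \<ge> 0\<close>, which does not
  meet the cut of \<open>powr\<close>; analyticity in \<open>L\<close> on the whole plane then fixes the values
  on the other sheets.\<close>

definition upper_Gamma_log :: "complex \<Rightarrow> complex \<Rightarrow> complex" where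
  "upper_Gamma_log a =
     (THE g. g holomorphic_on UNIV \<and>
        (\<forall>L. \<bar>Im L\<bar> < pi \<longrightarrow>
           ((\<lambda>u. (exp L + of_real u) powr (a - 1) * exp (- (exp L + of_real u)))
              has_integral g L) {0..}))"

text \<open>\<open>w e\<^sup>\<plusminus>\<^sup>i\<^sup>\<pi>\<^sup>/\<^sup>2\<close> has logarithm \<open>Ln w \<plusminus> i \<pi> / 2\<close>, which may lie
  outside the principal sheet.\<close>

definition Pi_term :: "complex \<Rightarrow> complex \<Rightarrow> complex" where
  "Pi_term p w = w powr p / 2 *
     (exp (of_real pi / 2 * \<i> * p) * exp (\<i> * w) *
        upper_Gamma_log (1 - p) (Ln w + of_real pi / 2 * \<i>)
    + exp (- (of_real pi / 2 * \<i> * p)) * exp (- (\<i> * w)) *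
        upper_Gamma_log (1 - p) (Ln w - of_real pi / 2 * \<i>))"

end

theory Submission
  imports Defs
begin

text \<open>
  The recurrence \<open>\<Gamma>(a + 1, z) = a \<Gamma>(a, z) + z\<^sup>a e\<^sup>-\<^sup>z\<close> gives
  \<open>\<Pi>\<^sub>p(w) = 1 - p (p + 1) \<Pi>\<^sub>p\<^sub>+\<^sub>2(w) / w\<^sup>2\<close>, so the \<open>k\<close>-th term of the expansion does not depend on
  \<open>N\<^sub>k\<close>: with \<open>w = (2k + 1) \<pi>\<close> it is \<open>s (1 - \<Pi>\<^sub>s\<^sub>+\<^sub>1(w q)) / (w\<^sup>2 q)\<close>. Since the numbers \<open>1 / w\<^sup>2\<close> add up to
  \<open>1/8\<close>, the claim becomes \<open>\<zeta>\<^sub>E(s, q) = R(s, q)\<close>, where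
  \<open>R(s, q) = q\<^sup>-\<^sup>s / 2 + 2 s q\<^sup>-\<^sup>s\<^sup>-\<^sup>1 \<Sum>\<^sub>k \<Pi>\<^sub>s\<^sub>+\<^sub>1(w q) / w\<^sup>2\<close>. The bounds on \<open>\<Pi>\<close> are locally uniform in \<open>s\<close> and uniform
  in \<open>k\<close>, so \<open>R\<close> is entire in \<open>s\<close>. For \<open>Re s > 0\<close> the terms are Fourier integrals of \<open>(q + x)\<^sup>-\<^sup>s\<^sup>-\<^sup>1\<close>
  over the half-line, and the half-range Fourier series on \<open>[0, 1]\<close> yields
  \<open>R(s, q) + R(s, q + 1) = q\<^sup>-\<^sup>s\<close>; as \<open>R(s, q + n)\<close> tends to 0, telescoping shows that \<open>R\<close> is the alternating series.
\<close>

section \<open>Improper integrals\<close>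


text \<open>The obstacle is the range of arguments. With w > 0 and q close to the cut, the two Gamma
  values inside \<open>Pi_term\<close> sit at arguments arg q + pi/2 and arg q - pi/2, of size up to
  3 pi/2, where the defining horizontal ray says nothing. In the coordinate t = exp L the form
  t^(a-1) exp(-t) dt becomes exp(a L - exp L) dL, which is entire; hence the continued function is
  minus an entire primitive, normalised to vanish as L tends to +infinity on the real axis.
  Everything about it is deduced from that derivative and that limit.

  For an integral formula valid on the whole slit plane, q is moved to q + x first and the rotation
  by a right angle is applied afterwards. Whatever the starting sheet, this path ends at argument
  +-pi/2, and it turns Gamma into an integral of (q + x)^(-p) against an oscillating exponential.
  Nothing decays except the power, so Re p > 1 is required; one use of the recurrence relaxes this
  to Re p > 0 and also cancels the factor w, and this cancellation is what makes the estimates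
  uniform in k.\<close>

lemma integrable_improper_dominated:
  fixes f :: "real \<Rightarrow> complex" and g :: "real \<Rightarrow> real"
  assumes f: "continuous_on {0..} f" and g: "g integrable_on {0..}"
    and le: "\<And>x. x \<ge> 0 \<Longrightarrow> norm (f x) \<le> g x"
  shows "f integrable_on {0..}"
    and "((\<lambda>T. integral {0..T} f) \<longlongrightarrow> integral {0..} f) at_top"
proof -
  have m: "f \<in> borel_measurable (lebesgue_on {0..})"
    by (rule continuous_imp_measurable_on_sets_lebesgue[OF f]) auto
  have ai: "f absolutely_integrable_on {0..}"
    by (rule measurable_bounded_by_integrable_imp_absolutely_integrable[OF m _ g]) (use le in auto)
  show "f integrable_on {0..}"
    using ai set_lebesgue_integral_eq_integral(1) by blast
  have "((\<lambda>T. set_lebesgue_integral lebesgue {0..T} f) \<longlongrightarrow> set_lebesgue_integral lebesgue {0..} f) at_top"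
    by (rule tendsto_set_lebesgue_integral_at_top[OF _ ai]) auto
  moreover have "set_lebesgue_integral lebesgue {0..} f = integral {0..} f"
    using ai set_lebesgue_integral_eq_integral(2) by blast
  moreover have "set_lebesgue_integral lebesgue {0..T} f = integral {0..T} f" for T
    by (rule set_lebesgue_integral_eq_integral(2), rule set_integrable_subset[OF ai]) auto
  ultimately show "((\<lambda>T. integral {0..T} f) \<longlongrightarrow> integral {0..} f) at_top" by simp
qed

text \<open>The existence of a limit of \<open>F\<close> at infinity is part of the conclusion: a
  dominated derivative suffices. The variant below serves when the limit is already known and the
  integral is wanted.\<close>

lemma improper_fundamental_theorem_of_calculus:
  fixes F :: "real \<Rightarrow> complex" and g :: "real \<Rightarrow> real"
  assumes F: "\<And>x. x \<ge> 0 \<Longrightarrow> (F has_vector_derivative f x) (at x within {0..})"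
    and f: "continuous_on {0..} f" and g: "g integrable_on {0..}"
    and le: "\<And>x. x \<ge> 0 \<Longrightarrow> norm (f x) \<le> g x"
  shows "(F \<longlongrightarrow> F 0 + integral {0..} f) at_top"
proof -
  have "eventually (\<lambda>T. F 0 + integral {0..T} f = F T) at_top"
  proof (rule eventually_mono[OF eventually_ge_at_top[of 0]])
    fix T :: real assume T: "T \<ge> 0"
    have "(f has_integral (F T - F 0)) {0..T}"
      by (rule fundamental_theorem_of_calculus[OF T])
         (auto intro: has_vector_derivative_within_subset[OF F])
    then show "F 0 + integral {0..T} f = F T" by (simp add: integral_unique)
  qed
  moreover have "((\<lambda>T. F 0 + integral {0..T} f) \<longlongrightarrow> F 0 + integral {0..} f) at_top"
    by (intro tendsto_intros integrable_improper_dominated(2)[OF f g le])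
  ultimately show ?thesis by (rule Lim_transform_eventually[rotated])
qed

lemma has_integral_improper_fundamental_theorem:
  fixes F :: "real \<Rightarrow> complex" and g :: "real \<Rightarrow> real"
  assumes F: "\<And>x. x \<ge> 0 \<Longrightarrow> (F has_vector_derivative f x) (at x within {0..})"
    and f: "continuous_on {0..} f" and g: "g integrable_on {0..}"
    and le: "\<And>x. x \<ge> 0 \<Longrightarrow> norm (f x) \<le> g x" and l: "(F \<longlongrightarrow> l) at_top"
  shows "(f has_integral (l - F 0)) {0..}"
proof -
  have "F 0 + integral {0..} f = l"
    by (rule tendsto_unique[OF _ improper_fundamental_theorem_of_calculus[OF F f g le] l]) auto
  then show ?thesis
    using integrable_improper_dominated(1)[OF f g le] by (auto simp: has_integral_iff algebra_simps)
qed

text \<open>Truncated integrals are holomorphic by the Leibniz rule on compact intervals, and local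
  domination makes them converge uniformly near each point. Only \<open>f\<close> itself has to be
  dominated, since a locally uniform limit of holomorphic functions is holomorphic.\<close>

lemma holomorphic_improper_integral:
  fixes f :: "complex \<Rightarrow> real \<Rightarrow> complex"
  assumes S: "open S"
    and f: "\<And>z. z \<in> S \<Longrightarrow> continuous_on {0..} (f z)"
    and deriv: "\<And>z x. z \<in> S \<Longrightarrow> x \<ge> 0 \<Longrightarrow> ((\<lambda>z. f z x) has_field_derivative f' z x) (at z)"
    and f': "continuous_on (S \<times> {0..}) (\<lambda>(z, x). f' z x)"
    and dom: "\<And>z. z \<in> S \<Longrightarrow> \<exists>d>0. \<exists>g. cball z d \<subseteq> S \<and> g integrable_on {0..} \<and>
                 (\<forall>p\<in>cball z d. \<forall>x\<ge>0. norm (f p x) \<le> g x)"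
  shows "(\<lambda>z. integral {0..} (f z)) holomorphic_on S"
proof (rule holomorphic_uniform_sequence[OF S])
  show "(\<lambda>z. integral {0..real n} (f z)) holomorphic_on S" for n
  proof -
    have "(\<lambda>z. integral (cbox 0 (real n)) (f z)) holomorphic_on ball z d" if "ball z d \<subseteq> S" for z d
      by (rule leibniz_rule_holomorphic[where fx = f'])
         (use that in \<open>auto intro!: has_field_derivative_at_within[OF deriv] integrable_continuous_interval
            continuous_on_subset[OF f] continuous_on_subset[OF f']\<close>)
    then show ?thesis
      using S by (auto simp: holomorphic_on_open open_contains_ball) 
         (metis centre_in_ball holomorphic_on_open open_ball)
  qed
next
  fix z assume "z \<in> S"
  then obtain d g where d: "d > 0" "cball z d \<subseteq> S" and g: "g integrable_on {0..}"
    and le: "\<And>p x. p \<in> cball z d \<Longrightarrow> x \<ge> 0 \<Longrightarrow> norm (f p x) \<le> g x"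
    using dom by metis
  have g0: "g x \<ge> 0" if "x \<ge> 0" for x
    using le[of z x] d that by (metis centre_in_cball less_le norm_ge_zero order_trans)
  have gai: "g absolutely_integrable_on {0..}"
    by (rule nonnegative_absolutely_integrable_1[OF g]) (use g0 in auto)
  have fi: "f p absolutely_integrable_on {0..}" if "p \<in> cball z d" for p
    by (rule measurable_bounded_by_integrable_imp_absolutely_integrable[OF _ _ g])
      (use le that d in \<open>auto intro!: continuous_imp_measurable_on_sets_lebesgue f\<close>)
  have fm: "set_borel_measurable lebesgue {0..} (f p)" if "p \<in> cball z d" for p
    using fi[OF that] unfolding set_borel_measurable_def set_integrable_def
    by (rule borel_measurable_integrable)
  have u: "uniform_limit (cball z d) (\<lambda>b p. LINT y:{0..b}|lebesgue. f p y)
           (\<lambda>p. LINT y:{0..}|lebesgue. f p y) at_top"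
    by (rule uniform_limit_set_lebesgue_integral_at_top[OF le gai fm]) auto
  have "uniform_limit (cball z d) (\<lambda>b p. integral {0..b} (f p)) (\<lambda>p. integral {0..} (f p)) at_top"
  proof (rule uniform_limit_cong[THEN iffD1, OF _ _ u])
    show "\<forall>\<^sub>F b in at_top. \<forall>p\<in>cball z d. (LINT y:{0..b}|lebesgue. f p y) = integral {0..b} (f p)"
      by (intro always_eventually allI ballI set_lebesgue_integral_eq_integral(2)
           set_integrable_subset[OF fi]) auto
  qed (use fi set_lebesgue_integral_eq_integral(2) in blast)
  then have "uniform_limit (cball z d) (\<lambda>n p. integral {0..real n} (f p)) (\<lambda>p. integral {0..} (f p)) sequentially"
    by (rule filterlim_compose[OF _ filterlim_real_sequentially])
  with d show "\<exists>d>0. cball z d \<subseteq> S \<and>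
      uniform_limit (cball z d) (\<lambda>n p. integral {0..real n} (f p)) (\<lambda>p. integral {0..} (f p)) sequentially"
    by blast
qed

section \<open>The incomplete Gamma function on the logarithmic surface\<close>


lemma norm_powr_le:
  fixes w p :: complex
  assumes "w \<noteq> 0"
  shows "norm (w powr p) \<le> norm w powr Re p * exp (pi * \<bar>Im p\<bar>)"
proof -
  have "- (Im p * Im (Ln w)) \<le> \<bar>Im p\<bar> * \<bar>Im (Ln w)\<bar>"
    by (metis abs_ge_minus_self abs_mult)
  also have "\<dots> \<le> \<bar>Im p\<bar> * pi"
    using Im_Ln_le_pi[OF assms] mpi_less_Im_Ln[OF assms] by (intro mult_left_mono) auto
  finally have "exp (Re p * ln (norm w) - Im p * Im (Ln w)) \<le> exp (Re p * ln (norm w) + pi * \<bar>Im p\<bar>)"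
    by (simp add: mult.commute)
  then show ?thesis
    using assms by (simp add: powr_def exp_add)
qed

text \<open>The ray from q avoids 0, so compactness handles a bounded stretch and the triangle
  inequality the rest. Having c at most 1 makes c^(-t) increasing in t, which later gives one
  constant for a whole range of exponents.\<close>

lemma slit_plane_norm_add_ge:
  fixes q :: complex
  assumes "q \<notin> \<real>\<^sub>\<le>\<^sub>0"
  obtains c where "0 < c" "c \<le> 1" "\<And>x. x \<ge> 0 \<Longrightarrow> c * (1 + x) \<le> norm (q + of_real x)"
proof -
  \<comment> \<open>Exactly the threshold beyond which x - |q| is at least (1 + x) / 2.\<close>
  define R where "R = 2 * norm q + 1"
  have R: "R \<ge> 0" by (simp add: R_def)
  have ne: "q + of_real x \<noteq> 0" if "x \<ge> 0" for x
  proof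
    assume "q + of_real x = 0"
    then have "q = of_real (-x)" by (simp add: eq_neg_iff_add_eq_0)
    with that assms show False by simp
  qed
  have "continuous_on {0..R} (\<lambda>x. norm (q + of_real x) / (1 + x))"
    by (intro continuous_intros) auto
  then have "\<exists>m\<in>{0..R}. \<forall>x\<in>{0..R}. norm (q + of_real m) / (1 + m) \<le> norm (q + of_real x) / (1 + x)"
    using R by (intro continuous_attains_inf) auto
  then obtain m where m: "m \<in> {0..R}"
    "\<And>x. x \<in> {0..R} \<Longrightarrow> norm (q + of_real m) / (1 + m) \<le> norm (q + of_real x) / (1 + x)"
    by blast
  define c where "c = min (1/2) (norm (q + of_real m) / (1 + m))"
  have "0 < c" using m(1) ne[of m] by (auto simp: c_def)
  moreover have c_le: "c \<le> 1/2" by (simp only: c_def min.cobounded1)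
  moreover have "c \<le> 1" using c_le by simp
  moreover have "c * (1 + x) \<le> norm (q + of_real x)" if x: "x \<ge> 0" for x
  proof (cases "x \<le> R")
    case True
    then have "c \<le> norm (q + of_real x) / (1 + x)" using m(2)[of x] x by (auto simp: c_def min_le_iff_disj)
    then show ?thesis using x by (simp add: field_simps)
  next
    case False
    have "c * (1 + x) \<le> 1/2 * (1 + x)" using x c_le by (intro mult_right_mono) auto
    also have "\<dots> \<le> x - norm q" using False by (simp add: R_def)
    also have "\<dots> \<le> norm (q + of_real x)"
      using norm_diff_ineq[of "of_real x" q] x by (simp add: add.commute)
    finally show ?thesis .
  qed
  ultimately show thesis using that by blast
qed

lemma powr_le_exp_half:
  fixes m :: real
  assumes m: "m \<ge> 0"
  obtains C where "0 < C" "\<And>u. u \<ge> 0 \<Longrightarrow> (1 + u) powr m \<le> C * exp (u / 2)"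
proof -
  \<comment> \<open>Small enough that m * e is at most 1/2; the bound then comes from ln y \<le> y
    at y = e * (1 + u).\<close>
  define e where "e = 1 / (2 * (m + 1))"
  have e: "e > 0" "m * e \<le> 1/2" using m by (auto simp: e_def field_simps)
  define C where "C = exp (m * (e - ln e))"
  have "(1 + u) powr m \<le> C * exp (u / 2)" if u: "u \<ge> 0" for u
  proof -
    have "ln (e * (1 + u)) \<le> e * (1 + u)"
      using e u ln_bound[of "e * (1 + u)"] by simp
    then have "ln (1 + u) \<le> e * (1 + u) - ln e"
      using e u by (simp add: ln_mult)
    then have "m * ln (1 + u) \<le> m * (e * (1 + u) - ln e)"
      using m by (rule mult_left_mono)
    also have "\<dots> = m * (e - ln e) + (m * e) * u" by (simp add: algebra_simps)
    also have "\<dots> \<le> m * (e - ln e) + 1/2 * u" using e u by (intro add_left_mono mult_right_mono) auto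
    finally have "exp (m * ln (1 + u)) \<le> exp (m * (e - ln e) + u / 2)" by simp
    then show ?thesis using u by (simp add: powr_def C_def exp_add)
  qed
  then show thesis using that[of C] by (simp add: C_def)
qed

text \<open>Half of the decay of exp(-u) absorbs a power of either sign, leaving exp(-u/2) as an
  integrable majorant.\<close>

lemma slit_plane_norm_powr_add_le:
  fixes q :: complex and r :: real
  assumes q: "q \<notin> \<real>\<^sub>\<le>\<^sub>0"
  obtains C where "0 < C" "\<And>u. u \<ge> 0 \<Longrightarrow> norm (q + of_real u) powr r \<le> C * exp (u / 2)"
proof -
  obtain c where c: "0 < c" "\<And>x. x \<ge> 0 \<Longrightarrow> c * (1 + x) \<le> norm (q + of_real x)"
    using slit_plane_norm_add_ge[OF q] by metis
  obtain C where C: "0 < C" "\<And>u. u \<ge> 0 \<Longrightarrow> (1 + u) powr \<bar>r\<bar> \<le> C * exp (u / 2)"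
    using powr_le_exp_half[of "\<bar>r\<bar>"] by auto
  \<comment> \<open>The first entry serves nonnegative exponents, through |q + u| \<le> (|q| + 1) (1
    + u); the second serves negative ones, through the lower bound c * (1 + u).\<close>
  define K where "K = max ((norm q + 1) powr r) (c powr r)"
  have K: "K > 0" using c by (simp add: K_def less_max_iff_disj)
  have "norm (q + of_real u) powr r \<le> K * C * exp (u / 2)" if u: "u \<ge> 0" for u
  proof -
    have "norm (q + of_real u) powr r \<le> K * (1 + u) powr \<bar>r\<bar>"
    proof (cases "r \<ge> 0")
      case True
      have "norm (q + of_real u) \<le> norm q + u" using norm_triangle_ineq[of q "of_real u"] u by simp
      also have "\<dots> \<le> (norm q + 1) * (1 + u)" using u by (simp add: algebra_simps)
      finally have "norm (q + of_real u) powr r \<le> ((norm q + 1) * (1 + u)) powr r"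
        using True by (intro powr_mono2) auto
      also have "\<dots> = (norm q + 1) powr r * (1 + u) powr r" using u by (simp add: powr_mult)
      also have "\<dots> \<le> K * (1 + u) powr r" by (intro mult_right_mono) (auto simp: K_def)
      finally show ?thesis using True by simp
    next
      case False
      have "norm (q + of_real u) powr r \<le> (c * (1 + u)) powr r"
        using False c(1) c(2)[OF u] u by (intro powr_mono2') auto
      also have "\<dots> = c powr r * (1 + u) powr r" using u c by (simp add: powr_mult)
      also have "\<dots> \<le> K * (1 + u) powr \<bar>r\<bar>"
        using K False u by (intro mult_mono powr_mono) (auto simp: K_def)
      finally show ?thesis .
    qed
    also have "\<dots> \<le> K * (C * exp (u / 2))" using K C(2)[OF u] by (intro mult_left_mono) auto
    finally show ?thesis by simp
  qed
  then show thesis using that[of "K * C"] K C by auto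
qed

text \<open>The mean value inequality on the vertical segment from the real point with the same real
  part. There Re (exp z) = exp (Re L) cos (Im z), and since cosine decreases on [0, pi] its minimum
  is attained at \<open>L\<close>. The lemma transfers limits from the real axis to curves that stay
  within |Im L| \<le> pi.\<close>

lemma exp_exp_primitive_bound:
  assumes P: "\<And>L. (P has_field_derivative exp (a * L - exp L)) (at L)" and L: "\<bar>Im L\<bar> \<le> pi"
  shows "norm (P L - P (of_real (Re L))) \<le>
           exp (Re a * Re L + \<bar>Im a\<bar> * \<bar>Im L\<bar> - Re (exp L)) * \<bar>Im L\<bar>"
proof -
  let ?S = "closed_segment (of_real (Re L)) L"
  have "norm (exp (a * z - exp z)) \<le> exp (Re a * Re L + \<bar>Im a\<bar> * \<bar>Im L\<bar> - Re (exp L))"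
    if z: "z \<in> ?S" for z
  proof -
    from z obtain t where t: "0 \<le> t" "t \<le> 1" "z = (1 - t) *\<^sub>R of_real (Re L) + t *\<^sub>R L"
      unfolding closed_segment_def by blast
    have Re: "Re z = Re L" and Im: "Im z = t * Im L" by (simp_all add: t(3) algebra_simps)
    have le: "\<bar>Im z\<bar> \<le> \<bar>Im L\<bar>" using t by (simp add: Im abs_mult mult_left_le_one_le)
    have "cos \<bar>Im L\<bar> \<le> cos \<bar>Im z\<bar>" using le L by (subst cos_mono_le_eq) auto
    then have "exp (Re L) * cos (Im L) \<le> exp (Re L) * cos (Im z)" by simp
    moreover have "- (Im a * Im z) \<le> \<bar>Im a\<bar> * \<bar>Im L\<bar>"
      using abs_ge_minus_self[of "Im a * Im z"] mult_left_mono[OF le, of "\<bar>Im a\<bar>"]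
      by (simp add: abs_mult)
    ultimately have "Re a * Re L - Im a * Im z - exp (Re L) * cos (Im z)
        \<le> Re a * Re L + \<bar>Im a\<bar> * \<bar>Im L\<bar> - exp (Re L) * cos (Im L)"
      by linarith
    then show ?thesis by (simp add: Re Re_exp)
  qed
  then have "norm (P L - P (of_real (Re L))) \<le>
      exp (Re a * Re L + \<bar>Im a\<bar> * \<bar>Im L\<bar> - Re (exp L)) * norm (L - of_real (Re L))"
    by (intro field_differentiable_bound[of ?S P "\<lambda>z. exp (a * z - exp z)"])
       (auto intro: has_field_derivative_at_within[OF P])
  also have "L - of_real (Re L) = \<i> * of_real (Im L)" by (simp add: complex_eq_iff)
  finally show ?thesis by (simp add: norm_mult)
qed

lemma exp_exp_primitive_limit:
  fixes P :: "complex \<Rightarrow> complex"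
  assumes P: "\<And>L. (P has_field_derivative exp (a * L - exp L)) (at L)"
  shows "\<exists>c. ((\<lambda>x. P (of_real x)) \<longlongrightarrow> c) at_top"
proof -
  \<comment> \<open>The extra 1 leaves a factor exp(-x), while b x \<le> b^2/2 + x^2/2 and x^2/2
    \<le> exp x dispose of the rest.\<close>
  define b where "b = \<bar>Re a\<bar> + 1"
  define f where "f = (\<lambda>x::real. exp (a * of_real x - exp (of_real x)))"
  have D: "((\<lambda>x. P (of_real x)) has_vector_derivative f x) (at x within {0..})" for x
  proof -
    have "(P has_field_derivative f x) (at (of_real x))" using P by (simp add: f_def)
    then show ?thesis
      using has_vector_derivative_real_field has_vector_derivative_at_within by blast
  qed
  have cont: "continuous_on {0..} f" unfolding f_def by (intro continuous_intros)
  have int: "(\<lambda>x. exp (b\<^sup>2 / 2) * exp (- 1 * x)) integrable_on {0..}"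
    by (rule has_integral_integrable[OF has_integral_mult_right[OF has_integral_exp_minus_to_infinity]]) simp
  have le: "norm (f x) \<le> exp (b\<^sup>2 / 2) * exp (- 1 * x)" if x: "x \<ge> 0" for x
  proof -
    have "Re a * x \<le> (b - 1) * x" using x by (intro mult_right_mono) (auto simp: b_def)
    moreover have "x\<^sup>2 / 2 \<le> exp x" using exp_lower_Taylor_quadratic[OF x] x by linarith
    moreover have "b * x \<le> b\<^sup>2 / 2 + x\<^sup>2 / 2" using sum_squares_bound[of b x] by simp
    ultimately have "Re a * x - exp x \<le> b\<^sup>2 / 2 + - 1 * x" by (simp add: algebra_simps)
    moreover have "norm (f x) = exp (Re a * x - exp x)"
      by (simp add: f_def exp_of_real flip: of_real_exp)
    ultimately show ?thesis by (simp add: exp_add[symmetric])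
  qed
  show ?thesis
    using improper_fundamental_theorem_of_calculus[OF D cont int le] by blast
qed

text \<open>The witness is c - P, where P is a primitive of the entire function exp(a L - exp L) and
  c its limit at +infinity on the real axis; being entire, it covers all sheets at once. On the
  principal sheet the horizontal ray is the curve Ln (z + u), so the claim is the fundamental
  theorem for P along that curve, once P is known to tend to the same c there.\<close>

lemma upper_Gamma_log_exists:
  "\<exists>g. (\<forall>L. (g has_field_derivative - exp (a * L - exp L)) (at L)) \<and>
       ((\<lambda>x. g (of_real x)) \<longlongrightarrow> 0) at_top \<and>
       (\<forall>L. \<bar>Im L\<bar> < pi \<longrightarrow>
           ((\<lambda>u. (exp L + of_real u) powr (a - 1) * exp (- (exp L + of_real u))) has_integral g L) {0..})"
proof -
  have "(\<lambda>L. exp (a * L - exp L)) holomorphic_on UNIV" by (intro holomorphic_intros)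
  from holomorphic_convex_primitive'[OF convex_UNIV open_UNIV this]
  obtain P where P: "\<And>L. (P has_field_derivative exp (a * L - exp L)) (at L)" by auto
  obtain c where c: "((\<lambda>x. P (of_real x)) \<longlongrightarrow> c) at_top"
    using exp_exp_primitive_limit[OF P] by blast
  have "((\<lambda>u. (exp L + of_real u) powr (a - 1) * exp (- (exp L + of_real u))) has_integral c - P L) {0..}"
    if L: "\<bar>Im L\<bar> < pi" for L
  proof -
    define z where "z = exp L"
    have LnL: "Ln z = L" using L by (simp add: z_def Ln_exp abs_less_iff)
    have z: "z \<notin> \<real>\<^sub>\<le>\<^sub>0"
    proof
      assume "z \<in> \<real>\<^sub>\<le>\<^sub>0"
      moreover have "z \<noteq> 0" by (simp add: z_def)
      ultimately have "Re z < 0" "Im z = 0"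
        by (auto simp: complex_nonpos_Reals_iff complex_eq_iff less_le)
      then have "Im (Ln z) = pi" using Im_Ln_eq_pi \<open>z \<noteq> 0\<close> by blast
      with LnL L show False by simp
    qed
    have zu: "z + of_real u \<notin> \<real>\<^sub>\<le>\<^sub>0" if "u \<ge> 0" for u
      using z that by (auto simp: complex_nonpos_Reals_iff)
    have zu0: "z + of_real u \<noteq> 0" if "u \<ge> 0" for u using zu[OF that] by auto
    define f where "f = (\<lambda>u. (z + of_real u) powr (a - 1) * exp (- (z + of_real u)))"
    define F where "F = (\<lambda>u. P (Ln (z + of_real u)))"
    \<comment> \<open>Two exponents occur: Re a - 1 for the integrand in t, and Re a for its form in
      the logarithmic coordinate.\<close>
    obtain C where C: "0 < C" "\<And>u. u \<ge> 0 \<Longrightarrow> norm (z + of_real u) powr (Re a - 1) \<le> C * exp (u / 2)"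
      using slit_plane_norm_powr_add_le[OF z] by metis
    obtain C' where C': "0 < C'" "\<And>u. u \<ge> 0 \<Longrightarrow> norm (z + of_real u) powr (Re a) \<le> C' * exp (u / 2)"
      using slit_plane_norm_powr_add_le[OF z] by metis
    have "(f has_integral c - F 0) {0..}"
    proof (rule has_integral_improper_fundamental_theorem)
      show "(F has_vector_derivative f u) (at u within {0..})" if u: "u \<ge> 0" for u
      proof -
        have "((\<lambda>y. P (Ln (z + y))) has_field_derivative
                exp (a * Ln (z + of_real u) - exp (Ln (z + of_real u))) * (1 / (z + of_real u))) (at (of_real u))"
          by (rule DERIV_chain2[OF P]) (use zu[OF u] in \<open>auto intro!: derivative_eq_intros simp: inverse_eq_divide\<close>)
        moreover have "exp (a * Ln y - exp (Ln y)) * (1 / y) = y powr (a - 1) * exp (- y)"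
          if "y \<noteq> 0" for y
          using that by (simp add: powr_diff powr_def exp_diff exp_minus field_simps)
        from this[OF zu0[OF u]]
        have "exp (a * Ln (z + of_real u) - exp (Ln (z + of_real u))) * (1 / (z + of_real u)) = f u"
          by (simp only: f_def)
        ultimately have "((\<lambda>y. P (Ln (z + y))) has_field_derivative f u) (at (of_real u))" by simp
        then show ?thesis unfolding F_def
          using has_vector_derivative_real_field has_vector_derivative_at_within by blast
      qed
      have "continuous_on {0..} (\<lambda>u. exp ((a - 1) * Ln (z + of_real u)) * exp (- (z + of_real u)))"
        by (intro continuous_intros) (use zu in auto)
      then show "continuous_on {0..} f"
        by (rule continuous_on_eq) (use zu0 in \<open>auto simp: f_def powr_def\<close>)
      show "(\<lambda>u. C * exp (pi * \<bar>Im a\<bar> - Re z) * exp (- (1/2) * u)) integrable_on {0..}"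
        by (rule has_integral_integrable[OF has_integral_mult_right[OF has_integral_exp_minus_to_infinity]]) simp
      show "norm (f u) \<le> C * exp (pi * \<bar>Im a\<bar> - Re z) * exp (- (1/2) * u)" if u: "u \<ge> 0" for u
      proof -
        have "norm (f u) \<le> (norm (z + of_real u) powr Re (a - 1) * exp (pi * \<bar>Im (a - 1)\<bar>)) * exp (- Re z - u)"
          unfolding f_def norm_mult using norm_powr_le[OF zu0[OF u], of "a - 1"]
          by (intro mult_mono) auto
        also have "\<dots> \<le> (C * exp (u / 2) * exp (pi * \<bar>Im a\<bar>)) * exp (- Re z - u)"
          using C(2)[OF u] by (intro mult_right_mono) auto
        also have "\<dots> = C * exp (u / 2 + pi * \<bar>Im a\<bar> + (- Re z - u))"
          by (simp only: exp_add mult.assoc)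
        also have "\<dots> = C * exp ((pi * \<bar>Im a\<bar> - Re z) + - (1/2) * u)" by (simp add: algebra_simps)
        finally show ?thesis by (simp only: exp_add mult.assoc)
      qed
      show "(F \<longlongrightarrow> c) at_top"
      proof -
        define N where "N = (\<lambda>u. norm (z + of_real u))"
        have N: "N u \<ge> u - norm z" for u
          using norm_diff_ineq[of "of_real u" z] by (simp add: N_def add.commute)
        have "filterlim N at_top at_top"
          by (rule filterlim_at_top_mono[of "\<lambda>u. u - norm z"]) (real_asymp, use N in auto)
        then have "filterlim (\<lambda>u. ln (N u)) at_top at_top"
          by (rule filterlim_compose[OF ln_at_top])
        then have lim1: "((\<lambda>u. P (of_real (ln (N u)))) \<longlongrightarrow> c) at_top"
          by (rule filterlim_compose[OF c])
        \<comment> \<open>The curve point and the real point with the same modulus differ by a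
          vertical segment. On it the factor exp(-Re z - u) beats the power of the modulus.\<close>
        have lim2: "((\<lambda>u. F u - P (of_real (ln (N u)))) \<longlongrightarrow> 0) at_top"
        proof (rule Lim_null_comparison)
          show "\<forall>\<^sub>F u in at_top. norm (F u - P (of_real (ln (N u)))) \<le>
                  (C' * pi * exp (pi * \<bar>Im a\<bar> - Re z)) * exp (- (1/2) * u)"
          proof (rule eventually_mono[OF eventually_ge_at_top[of 0]])
            fix u :: real assume u: "u \<ge> 0"
            define l where "l = Ln (z + of_real u)"
            have Rel: "Re l = ln (N u)" using zu0[OF u] by (simp add: l_def N_def)
            have expl: "exp l = z + of_real u" using zu0[OF u] by (simp add: l_def)
            have Iml: "\<bar>Im l\<bar> \<le> pi" using Im_Ln_le_pi[OF zu0[OF u]] mpi_less_Im_Ln[OF zu0[OF u]]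
              by (simp add: l_def)
            have "norm (F u - P (of_real (ln (N u)))) \<le>
               exp (Re a * Re l + \<bar>Im a\<bar> * \<bar>Im l\<bar> - Re (exp l)) * \<bar>Im l\<bar>"
              using exp_exp_primitive_bound[OF P Iml] unfolding Rel by (simp add: F_def l_def)
            also have "\<dots> \<le> exp (Re a * Re l + \<bar>Im a\<bar> * pi - Re (exp l)) * pi"
              using Iml by (intro mult_mono) (auto intro!: mult_left_mono)
            also have "\<dots> = N u powr Re a * (pi * exp (pi * \<bar>Im a\<bar> - Re z - u))"
              using zu0[OF u] by (simp add: Rel expl powr_def N_def exp_add exp_diff mult_ac)
            also have "\<dots> \<le> (C' * exp (u / 2)) * (pi * exp (pi * \<bar>Im a\<bar> - Re z - u))"
              using C'(2)[OF u] by (intro mult_right_mono) (auto simp: N_def)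
            also have "\<dots> = (C' * pi) * exp (u / 2 + (pi * \<bar>Im a\<bar> - Re z - u))"
              by (simp only: exp_add mult_ac)
            also have "\<dots> = (C' * pi) * exp ((pi * \<bar>Im a\<bar> - Re z) + - (1/2) * u)"
              by (simp add: algebra_simps)
            finally show "norm (F u - P (of_real (ln (N u)))) \<le>
                  (C' * pi * exp (pi * \<bar>Im a\<bar> - Re z)) * exp (- (1/2) * u)"
              by (simp only: exp_add mult.assoc)
          qed
          show "((\<lambda>u::real. (C' * pi * exp (pi * \<bar>Im a\<bar> - Re z)) * exp (- (1/2) * u)) \<longlongrightarrow> 0) at_top"
            by (intro tendsto_mult_right_zero) real_asymp
        qed
        from tendsto_add[OF lim2 lim1] show ?thesis by simp
      qed
    qed
    then show ?thesis by (simp add: F_def LnL f_def flip: z_def)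
  qed
  moreover have "((\<lambda>L. c - P L) has_field_derivative - exp (a * L - exp L)) (at L)" for L
    by (auto intro!: derivative_eq_intros P)
  moreover have "((\<lambda>x. c - P (of_real x)) \<longlongrightarrow> 0) at_top"
    using tendsto_diff[OF tendsto_const c, of c] by simp
  ultimately show ?thesis by (intro exI[of _ "\<lambda>L. c - P L"]) auto
qed

text \<open>The integral determines the function on the open strip |Im L| < pi, and the identity
  theorem extends uniqueness to the plane, which resolves the definite description. Later arguments
  use only these two properties.\<close>

lemma upper_Gamma_log_properties:
  shows has_field_derivative_upper_Gamma_log:
      "(upper_Gamma_log a has_field_derivative - exp (a * L - exp L)) (at L)" (is ?th1)
    and tendsto_upper_Gamma_log_at_top: "((\<lambda>x. upper_Gamma_log a (of_real x)) \<longlongrightarrow> 0) at_top" (is ?th2)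
proof -
  let ?P = "\<lambda>g. g holomorphic_on UNIV \<and>
        (\<forall>L. \<bar>Im L\<bar> < pi \<longrightarrow>
           ((\<lambda>u. (exp L + of_real u) powr (a - 1) * exp (- (exp L + of_real u))) has_integral g L) {0..})"
  from upper_Gamma_log_exists[of a] obtain g
    where g: "\<And>L. (g has_field_derivative - exp (a * L - exp L)) (at L)" 
      "((\<lambda>x. g (of_real x)) \<longlongrightarrow> 0) at_top"
      "\<forall>L. \<bar>Im L\<bar> < pi \<longrightarrow>
           ((\<lambda>u. (exp L + of_real u) powr (a - 1) * exp (- (exp L + of_real u))) has_integral g L) {0..}"
    by blast
  have hol: "g holomorphic_on UNIV"
    using g(1) by (auto simp: holomorphic_on_def field_differentiable_def)
  have "upper_Gamma_log a = g"
    unfolding upper_Gamma_log_def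
  proof (rule the_equality)
    show "?P g" using hol g by blast
    fix h assume h: "?P h"
    show "h = g"
    proof
      fix L
      have o: "open {L. \<bar>Im L\<bar> < pi}"
        by (intro open_Collect_less continuous_intros)
      show "h L = g L"
        by (rule analytic_continuation_open[OF o open_UNIV _ connected_UNIV _ _ hol])
          (use h g(3) in \<open>auto intro: has_integral_unique exI[of _ 0]\<close>)
    qed
  qed
  with g show ?th1 ?th2 by auto
qed


section \<open>Recurrences and the terms of the expansion\<close>

lemma upper_Gamma_log_plus1:
  "upper_Gamma_log (a + 1) L = a * upper_Gamma_log a L + exp (a * L - exp L)"
proof -
  \<comment> \<open>Zero derivative and zero limit along the real axis replace integration by parts,
    so the identity holds on every sheet.\<close>
  define h where "h = (\<lambda>L. upper_Gamma_log (a + 1) L - a * upper_Gamma_log a L - exp (a * L - exp L))"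
  have "(h has_field_derivative
          - exp ((a + 1) * L - exp L) - a * (- exp (a * L - exp L)) - (a - exp L) * exp (a * L - exp L))
          (at L)" for L
    unfolding h_def
    by (auto intro!: derivative_eq_intros has_field_derivative_upper_Gamma_log)
  moreover have "- exp ((a + 1) * L - exp L) - a * (- exp (a * L - exp L)) - (a - exp L) * exp (a * L - exp L) = 0" for L
    by (simp add: exp_add exp_diff field_simps)
  ultimately have "(h has_field_derivative 0) (at L)" for L by simp
  then obtain c where c: "\<And>L. h L = c"
    using has_field_derivative_zero_constant[OF convex_UNIV, of h] by auto
  have "((\<lambda>x::real. exp (a * of_real x - exp (of_real x))) \<longlongrightarrow> 0) at_top"
  proof (rule tendsto_norm_zero_cancel)
    have "((\<lambda>x::real. exp (Re a * x - exp x)) \<longlongrightarrow> 0) at_top" by real_asymp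
    then show "((\<lambda>x::real. norm (exp (a * of_real x - exp (of_real x)))) \<longlongrightarrow> 0) at_top"
      by (simp add: Re_exp)
  qed
  then have "((\<lambda>x. h (of_real x)) \<longlongrightarrow> 0 - a * 0 - 0) at_top"
    unfolding h_def by (intro tendsto_intros tendsto_upper_Gamma_log_at_top)
  then have "c = 0" by (simp add: c tendsto_const_iff)
  with c[of L] show ?thesis by (simp add: h_def algebra_simps)
qed

text \<open>This is z^p e^z Gamma(1 - p, z) at the point z with logarithm \<open>L\<close>. In this
  normalisation the recurrence has constant term 1, and \<open>Pi_term\<close> is the mean of two
  values.\<close>

definition scaled_Gamma :: "complex \<Rightarrow> complex \<Rightarrow> complex" where
  "scaled_Gamma p L = exp (p * L) * exp (exp L) * upper_Gamma_log (1 - p) L"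

lemma scaled_Gamma_rec: "scaled_Gamma p L = 1 - p / exp L * scaled_Gamma (p + 1) L"
  using upper_Gamma_log_plus1[of "-p" L]
  by (simp add: scaled_Gamma_def exp_add exp_diff exp_minus field_simps)

lemma exp_half_pi_ii: "exp (of_real pi / 2 * \<i>) = \<i>"
  using cis_pi_half by (simp add: cis_conv_exp mult.commute)

lemma exp_signed_half_pi_ii:
  assumes "\<bar>e\<bar> = 1"
  shows "exp (of_real (e * pi / 2) * \<i>) = of_real e * \<i>"
proof -
  have "e = 1 \<or> e = -1" using assms by linarith
  then show ?thesis using exp_half_pi_ii by (auto simp: exp_minus)
qed

lemma exp_Ln_rotate:
  assumes "w \<noteq> 0"
  shows "exp (Ln w + of_real pi / 2 * \<i>) = \<i> * w" "exp (Ln w - of_real pi / 2 * \<i>) = - (\<i> * w)"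
  using assms by (simp_all only: exp_add exp_diff exp_Ln exp_half_pi_ii) (simp_all add: field_simps)

lemma Pi_term_eq:
  assumes "w \<noteq> 0"
  shows "Pi_term p w = (scaled_Gamma p (Ln w + of_real pi / 2 * \<i>) + scaled_Gamma p (Ln w - of_real pi / 2 * \<i>)) / 2"
proof -
  have "exp (p * (Ln w + of_real pi / 2 * \<i>)) = w powr p * exp (of_real pi / 2 * \<i> * p)"
    "exp (p * (Ln w - of_real pi / 2 * \<i>)) = w powr p * exp (- (of_real pi / 2 * \<i> * p))"
    using assms by (simp_all add: powr_def exp_add[symmetric] algebra_simps)
  then show ?thesis
    by (simp only: Pi_term_def scaled_Gamma_def exp_Ln_rotate[OF assms]) (simp add: algebra_simps)
qed

text \<open>Apply the one-step recurrence twice at z = i w and z = -i w. The first-order terms p / z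
  are opposite and cancel in the mean, and z^2 = -w^2 in both cases.\<close>

lemma Pi_term_rec:
  assumes "w \<noteq> 0"
  shows "Pi_term p w = 1 - p * (p + 1) / w ^ 2 * Pi_term (p + 2) w"
proof -
  have 1: "p + 1 + 1 = p + 2" by simp
  note a = scaled_Gamma_rec[of p "Ln w + of_real pi / 2 * \<i>", unfolded
             scaled_Gamma_rec[of "p + 1" "Ln w + of_real pi / 2 * \<i>"] 1]
  note b = scaled_Gamma_rec[of p "Ln w - of_real pi / 2 * \<i>", unfolded
             scaled_Gamma_rec[of "p + 1" "Ln w - of_real pi / 2 * \<i>"] 1]
  show ?thesis unfolding Pi_term_eq[OF assms] a b exp_Ln_rotate[OF assms]
    using assms by (simp add: field_simps power2_eq_square)
qed

text \<open>Raising N by one replaces the remainder by the next explicit term plus a new remainder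
  of opposite sign, so the left side is constant in N; the right side is its value continued down to
  N = 0.\<close>

lemma expansion_term_eq:
  fixes s w q :: complex
  assumes "w \<noteq> 0" "q \<noteq> 0" "N > 0"
  shows "(\<Sum>n = 1..N - 1. (-1) ^ (n - 1) * (pochhammer s (2 * n + 1) / (w ^ (2 * n + 2) * q ^ (2 * n + 1)))) +
     (-1) ^ (N - 1) * (pochhammer s (2 * N + 1) * Pi_term (s + of_nat (2 * N + 1)) (w * q)
       / (w ^ (2 * N + 2) * q ^ (2 * N + 1))) = s / (w\<^sup>2 * q) * (1 - Pi_term (s + 1) (w * q))"
proof -
  have wq: "w * q \<noteq> 0" using assms by simp
  define b where "b = (\<lambda>n::nat. s + of_nat (2 * n + 1))"
  define c where "c = (\<lambda>n. pochhammer s (2 * n + 1) / (w ^ (2 * n + 2) * q ^ (2 * n + 1)))"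
  have step: "c n * Pi_term (b n) (w * q) = c n - c (Suc n) * Pi_term (b (Suc n)) (w * q)" for n
  proof -
    have c: "c (Suc n) = c n * (b n * (b n + 1) / (w * q)\<^sup>2)"
      using assms by (simp add: c_def b_def pochhammer_Suc power2_eq_square field_simps)
    have "b (Suc n) = b n + 2" by (simp add: b_def)
    then show ?thesis
      by (subst Pi_term_rec[OF wq]) (simp add: c algebra_simps)
  qed
  have "(\<Sum>n = 1..N - 1. (-1) ^ (n - 1) * c n) + (-1) ^ (N - 1) * (c N * Pi_term (b N) (w * q)) =
          c 0 * (1 - Pi_term (b 0) (w * q))" if "N > 0" for N
    using that
  proof (induction N rule: nat_induct_non_zero)
    case 1
    show ?case using step[of 0] by (simp add: algebra_simps)
  next
    case (Suc n)
    \<comment> \<open>Removes the truncated subtractions from the range of summation and from the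
      sign.\<close>
    then obtain m where m: "n = Suc m" by (metis gr0_implies_Suc)
    have "(\<Sum>n = 1..Suc n - 1. (-1) ^ (n - 1) * c n) + (-1) ^ (Suc n - 1) * (c (Suc n) * Pi_term (b (Suc n)) (w * q))
        = (\<Sum>n = 1..n - 1. (-1) ^ (n - 1) * c n) + (-1) ^ (n - 1) * (c n - c (Suc n) * Pi_term (b (Suc n)) (w * q))"
      unfolding m by (simp add: algebra_simps)
    then show ?case unfolding step[symmetric] Suc.IH .
  qed
  from this[OF \<open>N > 0\<close>] show ?thesis by (simp add: c_def b_def power2_eq_square)
qed

section \<open>Oscillatory integrals\<close>


lemma has_integral_add_powr_to_inf:
  fixes b r :: real
  assumes "b > 0" "r > 1"
  shows "((\<lambda>x. (b + x) powr - r) has_integral b powr (1 - r) / (r - 1)) {0..}"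
proof (rule has_integral_to_inf)
  define F where "F = (\<lambda>x. - ((b + x) powr (1 - r) / (r - 1)))"
  have deriv: "(F has_real_derivative (b + x) powr - r) (at x)" if "x \<ge> 0" for x
  proof -
    have "((\<lambda>x. (b + x) powr (1 - r)) has_real_derivative (1 - r) * (b + x) powr (1 - r - 1) * 1) (at x)"
      by (rule DERIV_chain2[OF has_real_derivative_powr]) (use that assms in \<open>auto intro!: derivative_eq_intros\<close>)
    moreover have "- ((1 - r) * (b + x) powr (1 - r - 1) * 1 / (r - 1)) = (b + x) powr - r"
      using assms by (simp add: field_simps)
    ultimately show ?thesis
      unfolding F_def using DERIV_minus[OF DERIV_cdivide, of _ _ _ _ "r - 1"] by metis
  qed
  have int: "((\<lambda>x. (b + x) powr - r) has_integral F y - F 0) {0..y}" if "y \<ge> 0" for y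
    by (rule fundamental_theorem_of_calculus[OF that])
      (use deriv in \<open>auto simp: has_real_derivative_iff_has_vector_derivative[symmetric]
         intro: has_field_derivative_at_within\<close>)
  then show "(\<lambda>x. (b + x) powr - r) integrable_on {0..y}" for y
    by (cases "y \<ge> 0") auto
  have "(F \<longlongrightarrow> 0) at_top" unfolding F_def using assms by real_asymp
  then have "((\<lambda>y. F y - F 0) \<longlongrightarrow> 0 - F 0) at_top" by (intro tendsto_intros)
  then have "((\<lambda>y. F y - F 0) \<longlongrightarrow> b powr (1 - r) / (r - 1)) at_top" by (simp add: F_def)
  then show "((\<lambda>y. integral {0..y} (\<lambda>x. (b + x) powr - r)) \<longlongrightarrow> b powr (1 - r) / (r - 1)) at_top"
    by (rule Lim_transform_eventually)
       (use int in \<open>auto intro!: eventually_mono[OF eventually_ge_at_top[of 0]] integral_unique[symmetric]\<close>)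
qed auto

lemma add_of_real_notin_nonpos_Reals:
  fixes q :: complex
  assumes "q \<notin> \<real>\<^sub>\<le>\<^sub>0" "x \<ge> 0"
  shows "q + of_real x \<notin> \<real>\<^sub>\<le>\<^sub>0" "q + of_real x \<noteq> 0"
proof -
  show *: "q + of_real x \<notin> \<real>\<^sub>\<le>\<^sub>0" using assms by (auto simp: complex_nonpos_Reals_iff)
  show "q + of_real x \<noteq> 0" using * by auto
qed

text \<open>One \<open>K\<close> for all exponents p in a rectangle: exp(pi B) pays for Im p and
  c^(-R) for Re p. This uniformity in p is what holomorphy and local boundedness require.\<close>

lemma slit_plane_powr_decay:
  fixes q :: complex
  assumes q: "q \<notin> \<real>\<^sub>\<le>\<^sub>0" and r: "0 \<le> r"
  obtains K where "0 < K" "\<And>p x. r \<le> Re p \<Longrightarrow> Re p \<le> R \<Longrightarrow> \<bar>Im p\<bar> \<le> B \<Longrightarrow> x \<ge> 0 \<Longrightarrow>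
                     norm ((q + of_real x) powr - p) \<le> K * (1 + x) powr - r"
proof -
  obtain c where c: "0 < c" "c \<le> 1" "\<And>x. x \<ge> 0 \<Longrightarrow> c * (1 + x) \<le> norm (q + of_real x)"
    using slit_plane_norm_add_ge[OF q] by metis
  have "norm ((q + of_real x) powr - p) \<le> (c powr - R * exp (pi * B)) * (1 + x) powr - r"
    if p: "r \<le> Re p" "Re p \<le> R" "\<bar>Im p\<bar> \<le> B" and x: "x \<ge> 0" for p x
  proof -
    have "norm (q + of_real x) powr - Re p \<le> (c * (1 + x)) powr - Re p"
      using c(1) c(3)[OF x] x p r by (intro powr_mono2') auto
    also have "\<dots> = c powr - Re p * (1 + x) powr - Re p" using c x by (simp add: powr_mult)
    also have "\<dots> \<le> c powr - R * (1 + x) powr - r"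
      using c x p by (intro mult_mono powr_mono powr_mono') auto
    finally have *: "norm (q + of_real x) powr - Re p \<le> c powr - R * (1 + x) powr - r" .
    have "norm ((q + of_real x) powr - p) \<le> norm (q + of_real x) powr - Re p * exp (pi * \<bar>Im p\<bar>)"
      using norm_powr_le[OF add_of_real_notin_nonpos_Reals(2)[OF q x], of "- p"] by simp
    also have "\<dots> \<le> (c powr - R * (1 + x) powr - r) * exp (pi * B)"
      using * p by (intro mult_mono) auto
    finally show ?thesis by (simp add: mult_ac)
  qed
  then show thesis using that[of "c powr - R * exp (pi * B)"] c by simp
qed

definition osc_integral :: "complex \<Rightarrow> complex \<Rightarrow> complex \<Rightarrow> complex" where
  "osc_integral c q p = integral {0..} (\<lambda>x. (q + of_real x) powr - p * exp (c * of_real x))"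

lemma continuous_on_osc_integrand:
  fixes q :: complex
  assumes "q \<notin> \<real>\<^sub>\<le>\<^sub>0"
  shows "continuous_on {0..} (\<lambda>x. (q + of_real x) powr - p * exp (c * of_real x))"
proof -
  have "continuous_on {0..} (\<lambda>x. exp (- p * Ln (q + of_real x)) * exp (c * of_real x))"
    by (intro continuous_intros) (use add_of_real_notin_nonpos_Reals[OF assms] in auto)
  then show ?thesis
    by (rule continuous_on_eq) (use add_of_real_notin_nonpos_Reals[OF assms] in \<open>auto simp: powr_def\<close>)
qed

lemma osc_integrand_dominated:
  assumes q: "q \<notin> \<real>\<^sub>\<le>\<^sub>0" and p: "Re p > 1" and c: "Re c = 0"
  obtains K where
    "(\<lambda>x. K * (1 + x) powr - Re p) integrable_on {0..}"
    "\<And>x. x \<ge> 0 \<Longrightarrow> norm ((q + of_real x) powr - p * exp (c * of_real x)) \<le> K * (1 + x) powr - Re p"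
proof -
  have p0: "0 \<le> Re p" using p by simp
  show thesis
  proof (rule slit_plane_powr_decay[OF q p0, of "Re p" "\<bar>Im p\<bar>"])
    fix K assume K: "\<And>p' x. Re p \<le> Re p' \<Longrightarrow> Re p' \<le> Re p \<Longrightarrow> \<bar>Im p'\<bar> \<le> \<bar>Im p\<bar> \<Longrightarrow> x \<ge> 0 \<Longrightarrow>
      norm ((q + of_real x) powr - p') \<le> K * (1 + x) powr - Re p"
    show thesis
    proof (rule that)
      show "(\<lambda>x. K * (1 + x) powr - Re p) integrable_on {0..}"
        by (rule has_integral_integrable[OF has_integral_mult_right[OF has_integral_add_powr_to_inf]])
          (use p in auto)
      show "norm ((q + of_real x) powr - p * exp (c * of_real x)) \<le> K * (1 + x) powr - Re p" if "x \<ge> 0" for x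
        using K[of p x] that c by (simp add: norm_mult)
    qed
  qed
qed

text \<open>The oscillating factor has modulus 1 and is discarded, so the bound does not depend on
  the frequency \<open>c\<close>.\<close>

lemma osc_integral_norm_le:
  assumes q: "q \<notin> \<real>\<^sub>\<le>\<^sub>0" and p: "Re p > 1" and c: "Re c = 0"
    and g: "(g has_integral G) {0..}" and le: "\<And>x. x \<ge> 0 \<Longrightarrow> norm ((q + of_real x) powr - p) \<le> g x"
  shows "norm (osc_integral c q p) \<le> G"
proof -
  obtain K where K: "(\<lambda>x. K * (1 + x) powr - Re p) integrable_on {0..}"
    "\<And>x. x \<ge> 0 \<Longrightarrow> norm ((q + of_real x) powr - p * exp (c * of_real x)) \<le> K * (1 + x) powr - Re p"
    using osc_integrand_dominated[OF q p c] by metis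
  have "norm (osc_integral c q p) \<le> integral {0..} g"
    unfolding osc_integral_def
    by (rule integral_norm_bound_integral)
      (use integrable_improper_dominated(1)[OF continuous_on_osc_integrand[OF q] K] g le c
        in \<open>auto simp: norm_mult\<close>)
  with g show ?thesis by (simp add: integral_unique)
qed

text \<open>Cut at 1 and translate the tail, working with truncations at T + 1. At odd multiples of
  i pi the factor \<open>exp c\<close> equals -1.\<close>

lemma osc_integral_shift:
  assumes q: "q \<notin> \<real>\<^sub>\<le>\<^sub>0" and p: "Re p > 1" and c: "Re c = 0"
  shows "osc_integral c q p = integral {0..1} (\<lambda>x. (q + of_real x) powr - p * exp (c * of_real x))
           + exp c * osc_integral c (q + 1) p"
proof -
  define f where "f = (\<lambda>q x. (q + of_real x) powr - p * exp (c * of_real x))"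
  have q1: "q + 1 \<notin> \<real>\<^sub>\<le>\<^sub>0" using add_of_real_notin_nonpos_Reals[OF q, of 1] by simp
  have lim: "((\<lambda>T. integral {0..T} (f q)) \<longlongrightarrow> osc_integral c q p) at_top" if q: "q \<notin> \<real>\<^sub>\<le>\<^sub>0" for q
  proof -
    obtain K where K: "(\<lambda>x. K * (1 + x) powr - Re p) integrable_on {0..}"
      "\<And>x. x \<ge> 0 \<Longrightarrow> norm ((q + of_real x) powr - p * exp (c * of_real x)) \<le> K * (1 + x) powr - Re p"
      using osc_integrand_dominated[OF q p c] by metis
    show ?thesis unfolding f_def osc_integral_def
      by (rule integrable_improper_dominated(2)[OF continuous_on_osc_integrand[OF q] K])
  qed
  have eq: "integral {0..T + 1} (f q) = integral {0..1} (f q) + exp c * integral {0..T} (f (q + 1))"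
    if T: "T \<ge> 0" for T
  proof -
    have cont: "continuous_on {0..} (f q)"
      unfolding f_def by (rule continuous_on_osc_integrand[OF q])
    have "integral {0..1} (f q) + integral {1..T + 1} (f q) = integral {0..T + 1} (f q)"
      by (rule Henstock_Kurzweil_Integration.integral_combine)
        (use T in \<open>auto intro!: integrable_continuous_interval continuous_on_subset[OF cont]\<close>)
    moreover have "integral {0..T} (f q \<circ> (\<lambda>x. x + 1)) = integral {0 + 1..T + 1} (f q)"
      by (rule integral_shift) (auto intro!: continuous_on_subset[OF cont])
    moreover have "f q \<circ> (\<lambda>x. x + 1) = (\<lambda>x. exp c * f (q + 1) x)"
      by (auto simp: f_def fun_eq_iff algebra_simps exp_add)
    ultimately show ?thesis by simp
  qed
  have "((\<lambda>T. integral {0..T + 1} (f q)) \<longlongrightarrow> osc_integral c q p) at_top"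
    by (rule filterlim_compose[OF lim[OF q]]) real_asymp
  moreover have "((\<lambda>T. integral {0..T + 1} (f q)) \<longlongrightarrow>
      integral {0..1} (f q) + exp c * osc_integral c (q + 1) p) at_top"
  proof (rule Lim_transform_eventually)
    show "((\<lambda>T. integral {0..1} (f q) + exp c * integral {0..T} (f (q + 1))) \<longlongrightarrow>
      integral {0..1} (f q) + exp c * osc_integral c (q + 1) p) at_top"
      by (intro tendsto_intros lim q1)
  qed (rule eventually_mono[OF eventually_ge_at_top[of 0]], use eq in auto)
  ultimately show ?thesis unfolding f_def by (rule tendsto_unique[rotated]) simp
qed

lemma holomorphic_osc_integral:
  assumes q: "q \<notin> \<real>\<^sub>\<le>\<^sub>0" and c: "Re c = 0"
  shows "osc_integral c q holomorphic_on {p. Re p > 1}"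
  unfolding osc_integral_def
proof (rule holomorphic_improper_integral[where f' = "\<lambda>p x. - Ln (q + of_real x) * ((q + of_real x) powr - p * exp (c * of_real x))"])
  show "open {p. Re p > 1}" by (rule open_halfspace_Re_gt)
  show "continuous_on {0..} (\<lambda>x. (q + of_real x) powr - p * exp (c * of_real x))" for p
    by (rule continuous_on_osc_integrand[OF q])
  show "((\<lambda>p. (q + of_real x) powr - p * exp (c * of_real x)) has_field_derivative
          - Ln (q + of_real x) * ((q + of_real x) powr - p * exp (c * of_real x))) (at p)"
    if "x \<ge> 0" for p x
    using add_of_real_notin_nonpos_Reals[OF q that]
    by (auto intro!: derivative_eq_intros simp: powr_def)
  have "continuous_on ({p. 1 < Re p} \<times> {0..}) 
     (\<lambda>y. - Ln (q + of_real (snd y)) * (exp (- fst y * Ln (q + of_real (snd y))) * exp (c * of_real (snd y))))"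
    by (intro continuous_intros) (use add_of_real_notin_nonpos_Reals[OF q] in auto)
  then show "continuous_on ({p. 1 < Re p} \<times> {0..}) 
     (\<lambda>(p, x). - Ln (q + of_real x) * ((q + of_real x) powr - p * exp (c * of_real x)))"
    by (rule continuous_on_eq)
      (use add_of_real_notin_nonpos_Reals[OF q] in \<open>auto simp: powr_def\<close>)
  fix z assume "z \<in> {p. 1 < Re p}"
  \<comment> \<open>Half the distance to the line Re p = 1, so the closed ball stays in Re p \<ge> 1
    + d and the majorant remains integrable.\<close>
  define d where "d = (Re z - 1) / 2"
  have d: "d > 0" "Re z - d = 1 + d" using \<open>z \<in> _\<close> by (auto simp: d_def field_simps)
  have ball: "1 + d \<le> Re p \<and> Re p \<le> Re z + d \<and> \<bar>Im p\<bar> \<le> \<bar>Im z\<bar> + d" if "p \<in> cball z d" for p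
  proof -
    have "\<bar>Re (z - p)\<bar> \<le> d" "\<bar>Im (z - p)\<bar> \<le> d"
      using that abs_Re_le_cmod[of "z - p"] abs_Im_le_cmod[of "z - p"] by (auto simp: dist_norm)
    then show ?thesis using d by auto
  qed
  have r0: "0 \<le> 1 + d" using d by simp
  obtain K where K: "\<And>p x. 1 + d \<le> Re p \<Longrightarrow> Re p \<le> Re z + d \<Longrightarrow> \<bar>Im p\<bar> \<le> \<bar>Im z\<bar> + d \<Longrightarrow> x \<ge> 0 \<Longrightarrow>
         norm ((q + of_real x) powr - p) \<le> K * (1 + x) powr - (1 + d)"
    by (rule slit_plane_powr_decay[OF q r0, of "Re z + d" "\<bar>Im z\<bar> + d"]) (rule that, blast)
  show "\<exists>d>0. \<exists>g. cball z d \<subseteq> {p. 1 < Re p} \<and> g integrable_on {0..} \<and>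
          (\<forall>p\<in>cball z d. \<forall>x\<ge>0. norm ((q + of_real x) powr - p * exp (c * of_real x)) \<le> g x)"
  proof (intro exI conjI ballI allI impI)
    show "(\<lambda>x. K * (1 + x) powr - (1 + d)) integrable_on {0..}"
      by (rule has_integral_integrable[OF has_integral_mult_right[OF has_integral_add_powr_to_inf]])
        (use d in auto)
    show "cball z d \<subseteq> {p. 1 < Re p}" using ball d by fastforce
    show "norm ((q + of_real x) powr - p * exp (c * of_real x)) \<le> K * (1 + x) powr - (1 + d)"
      if "p \<in> cball z d" "x \<ge> 0" for p x
      using K[of p x] ball[OF that(1)] that(2) c by (simp add: norm_mult)
  qed (rule d)
qed

text \<open>Follow \<open>upper_Gamma_log (1 - p)\<close> along the curve Ln (q + x) + l0, which
  starts at the required point of the surface, possibly off the principal sheet. There exp L = -c (q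
  + x) with c = i e w, so by the chain rule the derivative in x is a constant times the oscillatory
  integrand. It remains to see that the function vanishes at the far end.\<close>

lemma scaled_Gamma_eq_osc_integral:
  fixes e w :: real
  assumes q: "q \<notin> \<real>\<^sub>\<le>\<^sub>0" and w: "w > 0" and e: "\<bar>e\<bar> = 1" and p: "Re p > 1"
  shows "scaled_Gamma p (Ln q + of_real (ln w) - of_real (e * pi / 2) * \<i>) =
           - (\<i> * of_real (e * w)) * q powr p * osc_integral (\<i> * of_real (e * w)) q p"
proof -
  define c where "c = \<i> * of_real (e * w)"
  define a where "a = 1 - p"
  define l0 where "l0 = of_real (ln w) - of_real (e * pi / 2) * \<i>"
  define L where "L = (\<lambda>x. Ln (q + of_real x) + l0)"
  note qx = add_of_real_notin_nonpos_Reals[OF q]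
  have "exp l0 = of_real w / (of_real e * \<i>)"
    using w exp_signed_half_pi_ii[OF e] by (simp add: l0_def exp_diff exp_of_real)
  also have "\<dots> = - c"
    using e by (auto simp: c_def field_simps abs_if split: if_splits)
  finally have el0: "exp l0 = - c" .
  have expL: "exp (L x) = - c * (q + of_real x)" if "x \<ge> 0" for x
    using qx(2)[OF that] by (simp add: L_def exp_add el0)
  define f where "f = (\<lambda>x. (q + of_real x) powr - p * exp (c * of_real x))"
  define F where "F = (\<lambda>x. upper_Gamma_log a (L x))"
  \<comment> \<open>Collects the factors independent of x: c and exp (-p l0) come from the power of
    exp L, and exp (c q) from exp (-exp L).\<close>
  define D where "D = c * exp (- p * l0) * exp (c * q)"
  have c0: "Re c = 0" by (simp add: c_def)
  obtain K where K: "(\<lambda>x. K * (1 + x) powr - Re p) integrable_on {0..}"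
      "\<And>x. x \<ge> 0 \<Longrightarrow> norm (f x) \<le> K * (1 + x) powr - Re p"
    using osc_integrand_dominated[OF q p c0] unfolding f_def by metis
  have "((\<lambda>x. D * f x) has_integral (0 - F 0)) {0..}"
  proof (rule has_integral_improper_fundamental_theorem)
    show "(F has_vector_derivative D * f x) (at x within {0..})" if x: "x \<ge> 0" for x
    proof -
      have "((\<lambda>y. upper_Gamma_log a (Ln (q + y) + l0)) has_field_derivative
              - exp (a * L x - exp (L x)) * (1 / (q + of_real x))) (at (of_real x))"
        unfolding L_def
        by (rule DERIV_chain2[OF has_field_derivative_upper_Gamma_log])
           (use qx[OF x] in \<open>auto intro!: derivative_eq_intros simp: inverse_eq_divide\<close>)
      moreover have "- exp (a * L x - exp (L x)) * (1 / (q + of_real x)) = D * f x"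
      proof -
        have "exp (a * L x - exp (L x)) = exp (L x) * exp (- p * L x) * exp (- exp (L x))"
          by (simp add: a_def exp_add[symmetric] algebra_simps)
        also have "exp (- p * L x) = (q + of_real x) powr - p * exp (- p * l0)"
          using qx[OF x] by (simp add: L_def powr_def exp_add[symmetric] algebra_simps)
        also have "exp (- exp (L x)) = exp (c * q) * exp (c * of_real x)"
          by (simp add: expL[OF x] exp_add[symmetric] algebra_simps)
        finally show ?thesis
          using qx(2)[OF x] by (simp add: expL[OF x] D_def f_def)
      qed
      ultimately have "((\<lambda>y. upper_Gamma_log a (Ln (q + y) + l0)) has_field_derivative D * f x) (at (of_real x))"
        by simp
      then show ?thesis unfolding F_def L_def
        using has_vector_derivative_real_field has_vector_derivative_at_within by blast
    qed
    show "continuous_on {0..} (\<lambda>x. D * f x)"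
      unfolding f_def by (intro continuous_intros continuous_on_osc_integrand[OF q])
    show "(\<lambda>x. norm D * (K * (1 + x) powr - Re p)) integrable_on {0..}"
      by (rule has_integral_integrable[OF has_integral_mult_right[OF integrable_integral[OF K(1)]]])
    show "norm (D * f x) \<le> norm D * (K * (1 + x) powr - Re p)" if "x \<ge> 0" for x
      using K(2)[OF that] by (simp add: norm_mult mult_left_mono)
    show "(F \<longlongrightarrow> 0) at_top"
    proof -
      define N where "N = (\<lambda>x. ln (norm (q + of_real x)) + ln w)"
      have "norm (q + of_real u) \<ge> u - norm q" for u
        using norm_diff_ineq[of "of_real u" q] by (simp add: add.commute)
      moreover have "filterlim (\<lambda>u. u - norm q) at_top at_top" by real_asymp
      ultimately have "filterlim (\<lambda>u. norm (q + of_real u)) at_top at_top"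
        by (auto intro: filterlim_at_top_mono)
      from filterlim_tendsto_add_at_top[OF tendsto_const[of "ln w"] filterlim_compose[OF ln_at_top this]]
      have N: "filterlim N at_top at_top" by (simp add: N_def add.commute)
      then have lim1: "((\<lambda>x. upper_Gamma_log a (of_real (N x))) \<longlongrightarrow> 0) at_top"
        by (rule filterlim_compose[OF tendsto_upper_Gamma_log_at_top])
      have lim2: "((\<lambda>x. F x - upper_Gamma_log a (of_real (N x))) \<longlongrightarrow> 0) at_top"
      proof (rule Lim_null_comparison)
        show "\<forall>\<^sub>F x in at_top. norm (F x - upper_Gamma_log a (of_real (N x))) \<le>
                exp (Re a * N x + (\<bar>Im a\<bar> * pi + w * \<bar>Im q\<bar>)) * pi"
        \<comment> \<open>From x = |q| on, q + x has nonnegative real part, so its argument is at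
          most pi/2 in size; the rotation adds pi/2 at most, and
          \<open>exp_exp_primitive_bound\<close> becomes applicable.\<close>
        proof (rule eventually_mono[OF eventually_ge_at_top[of "norm q"]])
          fix x assume x: "x \<ge> norm q"
          then have x0: "x \<ge> 0" using norm_ge_zero[of q] by linarith
          have Re: "Re (L x) = N x" using qx(2)[OF x0] by (simp add: L_def l0_def N_def)
          have "Re (q + of_real x) \<ge> 0" using x abs_Re_le_cmod[of q] by auto
          then have "\<bar>Im (Ln (q + of_real x))\<bar> \<le> pi / 2"
            using Re_Ln_pos_le[OF qx(2)[OF x0]] by simp
          moreover have "\<bar>e * pi / 2\<bar> \<le> pi / 2" using e by (simp add: abs_mult)
          ultimately have Im: "\<bar>Im (L x)\<bar> \<le> pi" by (simp add: L_def l0_def)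
          have "Re (exp (L x)) = e * w * Im q" by (simp add: expL[OF x0] c_def)
          moreover have "\<bar>e * w * Im q\<bar> = w * \<bar>Im q\<bar>" using e w by (simp add: abs_mult)
          ultimately have ge: "Re (exp (L x)) \<ge> - (w * \<bar>Im q\<bar>)" by linarith
          have D: "((\<lambda>L. - upper_Gamma_log a L) has_field_derivative exp (a * L - exp L)) (at L)" for L
            using DERIV_minus[OF has_field_derivative_upper_Gamma_log[of a L]] by simp
          have "norm (F x - upper_Gamma_log a (of_real (N x))) \<le>
             exp (Re a * N x + \<bar>Im a\<bar> * \<bar>Im (L x)\<bar> - Re (exp (L x))) * \<bar>Im (L x)\<bar>"
            using exp_exp_primitive_bound[OF D Im] by (simp add: Re F_def norm_minus_commute)
          also have "\<dots> \<le> exp (Re a * N x + (\<bar>Im a\<bar> * pi + w * \<bar>Im q\<bar>)) * pi"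
            using Im ge mult_left_mono[OF Im, of "\<bar>Im a\<bar>"] by (intro mult_mono) auto
          finally show "norm (F x - upper_Gamma_log a (of_real (N x))) \<le>
                exp (Re a * N x + (\<bar>Im a\<bar> * pi + w * \<bar>Im q\<bar>)) * pi" .
        qed
        \<comment> \<open>Since Re (exp (L x)) stays bounded, the exponential gives no decay here;
          it comes from Re a = 1 - Re p alone.\<close>
        have "Re a < 0" using p by (simp add: a_def)
        then have "((\<lambda>y. exp (Re a * y + (\<bar>Im a\<bar> * pi + w * \<bar>Im q\<bar>)) * pi) \<longlongrightarrow> 0) at_top"
          by real_asymp
        from filterlim_compose[OF this N]
        show "((\<lambda>x. exp (Re a * N x + (\<bar>Im a\<bar> * pi + w * \<bar>Im q\<bar>)) * pi) \<longlongrightarrow> 0) at_top" .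
      qed
      from tendsto_add[OF lim2 lim1] show ?thesis by simp
    qed
  qed
  then have "D * osc_integral c q p = - F 0"
    by (simp add: osc_integral_def f_def has_integral_iff flip: integral_mult_right)
  then have F0: "upper_Gamma_log a (Ln q + l0) = - (D * osc_integral c q p)"
    by (simp add: F_def L_def)
  have q0: "q \<noteq> 0" using q by auto
  have "scaled_Gamma p (Ln q + l0) = exp (p * (Ln q + l0)) * exp (- c * q) * (- (D * osc_integral c q p))"
    using q0 by (simp add: scaled_Gamma_def flip: a_def F0) (simp add: exp_add el0 mult.commute)
  also have "\<dots> = - c * (exp (p * Ln q) * exp (p * l0) * exp (- p * l0)) * (exp (- c * q) * exp (c * q)) * osc_integral c q p"
    by (simp add: D_def exp_add distrib_left)
  also have "\<dots> = - c * q powr p * osc_integral c q p"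
    using q0 by (simp add: powr_def exp_minus)
  finally show ?thesis by (simp add: l0_def c_def add_diff_eq)
qed

section \<open>Half-range Fourier series\<close>


lemma holomorphic_factor_zeros_0_1:
  assumes f: "f holomorphic_on S" and S: "open S" "0 \<in> S" "1 \<in> S" and z: "f 0 = 0" "f 1 = 0"
  obtains F where "F holomorphic_on S" "\<And>z. z \<in> S \<Longrightarrow> f z = z * (z - 1) * F z"
proof -
  define F1 where "F1 = (\<lambda>z. if z = 0 then deriv f 0 else (f z - f 0) / (z - 0))"
  define F where "F = (\<lambda>z. if z = 1 then deriv F1 1 else (F1 z - F1 1) / (z - 1))"
  have F1: "F1 holomorphic_on S"
    unfolding F1_def by (rule pole_lemma_open[OF f S(1)])
  have F: "F holomorphic_on S"
    unfolding F_def by (rule pole_lemma_open[OF F1 S(1)])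
  have "f z = z * (z - 1) * F z" for z
    using z by (auto simp: F_def F1_def)
  with F show thesis using that by blast
qed

text \<open>Both f and sin (pi z) contain the factor z (z - 1). The cofactor G of the sine has no
  zero on [0, 1]: at the endpoints its value is -pi because of the derivative of the sine, and in
  between the sine is positive. Shrinking S to where G is nonzero makes the quotient
  holomorphic.\<close>

lemma holomorphic_divide_sin:
  assumes f: "f holomorphic_on S" and S: "open S" "of_real ` {0..1} \<subseteq> S" and z: "f 0 = 0" "f 1 = 0"
  obtains g T where "g holomorphic_on T" "open T" "of_real ` {0..1} \<subseteq> T"
    "\<And>x. x \<in> {0..1} \<Longrightarrow> f (of_real x) = g (of_real x) * of_real (sin (pi * x))"
proof -
  have "of_real 0 \<in> S" "of_real 1 \<in> S" using S(2) by (auto simp del: of_real_0 of_real_1)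
  then have "0 \<in> S" "1 \<in> S" by simp_all
  with f S z obtain F where F: "F holomorphic_on S" "\<And>z. z \<in> S \<Longrightarrow> f z = z * (z - 1) * F z"
    using holomorphic_factor_zeros_0_1 by metis
  obtain G :: "complex \<Rightarrow> complex" where G: "G holomorphic_on UNIV" "\<And>z. sin (of_real pi * z) = z * (z - 1) * G z"
    by (rule holomorphic_factor_zeros_0_1[of "\<lambda>z. sin (of_real pi * z)" UNIV])
       (auto intro!: holomorphic_intros simp flip: sin_of_real)
  have der: "((\<lambda>z. sin (of_real pi * z)) has_field_derivative (2 * x - 1) * G x + x * (x - 1) * deriv G x) (at x)" for x
  proof -
    have "(G has_field_derivative deriv G x) (at x)"
      using G(1) by (rule holomorphic_derivI) auto
    then show ?thesis unfolding G(2)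
      by (auto intro!: derivative_eq_intros simp: algebra_simps)
  qed
  have der': "((\<lambda>z. sin (of_real pi * z)) has_field_derivative of_real pi * cos (of_real pi * x)) (at x)" for x :: complex
    by (auto intro!: derivative_eq_intros)
  have "- G 0 = of_real pi" using DERIV_unique[OF der[of 0] der'[of 0]] by simp
  then have "G 0 \<noteq> 0" by auto
  moreover have "G 1 = - of_real pi" using DERIV_unique[OF der[of 1] der'[of 1]]
    by (simp flip: cos_of_real)
  then have "G 1 \<noteq> 0" by auto
  moreover have "G (of_real x) \<noteq> 0" if "0 < x" "x < 1" for x
  proof -
    have "sin (pi * x) > 0" using that by (intro sin_gt_zero) auto
    moreover have "of_real (sin (pi * x)) = sin (of_real pi * of_real x :: complex)"
      by (simp flip: sin_of_real)
    ultimately show ?thesis using G(2)[of "of_real x"] by (metis less_irrefl mult_zero_right of_real_eq_0_iff)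
  qed
  ultimately have G0: "G (of_real x) \<noteq> 0" if "x \<in> {0..1}" for x
    using that by (cases "x = 0 \<or> x = 1") auto
  define T where "T = S \<inter> {z. G z \<noteq> 0}"
  show thesis
  proof (rule that)
    show "(\<lambda>z. F z / G z) holomorphic_on T"
      by (intro holomorphic_intros holomorphic_on_subset[OF F(1)] holomorphic_on_subset[OF G(1)])
         (auto simp: T_def)
    have "continuous_on UNIV G" by (rule holomorphic_on_imp_continuous_on[OF G(1)])
    then show "open T" unfolding T_def
      by (intro open_Int S open_Collect_neq) auto
    show "of_real ` {0..1} \<subseteq> T" using S(2) G0 by (auto simp: T_def)
    show "f (of_real x) = F (of_real x) / G (of_real x) * of_real (sin (pi * x))" if "x \<in> {0..1}" for x
    proof -
      have "of_real x \<in> S" using that S(2) by auto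
      then show ?thesis using G0[OF that] F(2)[of "of_real x"] G(2)[of "of_real x"]
        by (simp flip: sin_of_real of_real_mult)
    qed
  qed
qed

lemma has_vector_derivative_holomorphic_of_real:
  assumes "g holomorphic_on T" "open T" "of_real x \<in> T"
  shows "((\<lambda>x. g (of_real x)) has_vector_derivative deriv g (of_real x)) (at x within A)"
  using has_vector_derivative_real_field[OF holomorphic_derivI[OF assms]] 
  by (rule has_vector_derivative_at_within)

text \<open>A single integration by parts gives the rate 1/n, because g has a bounded derivative on
  [0, 1].\<close>

lemma riemann_lebesgue_sin:
  assumes g: "g holomorphic_on T" and T: "open T" "of_real ` {0..1} \<subseteq> T"
  shows "(\<lambda>n. integral {0..1} (\<lambda>x. g (of_real x) * of_real (sin (2 * real n * pi * x)))) \<longlonglongrightarrow> 0"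
proof -
  have cg: "continuous_on {0..1} (\<lambda>x. g (of_real x))"
    by (rule continuous_on_compose2[OF holomorphic_on_imp_continuous_on[OF g]])
       (use T in \<open>auto intro!: continuous_intros\<close>)
  have "deriv g holomorphic_on T" using g T by (intro holomorphic_deriv)
  then have cd: "continuous_on {0..1} (\<lambda>x. deriv g (of_real x))"
    by (intro continuous_on_compose2[OF holomorphic_on_imp_continuous_on, of "deriv g" T])
       (use T in \<open>auto intro!: continuous_intros\<close>)
  have "bounded ((\<lambda>x. deriv g (of_real x)) ` {0..1})"
    by (intro compact_imp_bounded compact_continuous_image cd compact_Icc)
  then obtain B where B: "\<And>x. x \<in> {0..1} \<Longrightarrow> norm (deriv g (of_real x)) \<le> B"
    unfolding bounded_iff by blast
  define C where "C = norm (g 0) + norm (g 1) + B"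
  have "norm (integral {0..1} (\<lambda>x. g (of_real x) * of_real (sin (2 * real n * pi * x)))) \<le> C / (2 * pi) * (1 / real n)"
    if n: "n > 0" for n
  proof -
    define w where "w = 2 * real n * pi"
    have w: "w > 0" using n by (simp add: w_def)
    define F where "F = (\<lambda>x. - (g (of_real x) * of_real (cos (w * x))) / of_real w)"
    have i1: "(\<lambda>x. deriv g (of_real x) * of_real (cos (w * x))) integrable_on {0..1}"
      by (intro integrable_continuous_interval continuous_intros cd)
    have i2: "(\<lambda>x. g (of_real x) * of_real (sin (w * x))) integrable_on {0..1}"
      by (intro integrable_continuous_interval continuous_intros cg)
    have "((\<lambda>x. g (of_real x) * of_real (sin (w * x)) - deriv g (of_real x) * of_real (cos (w * x)) / of_real w)
             has_integral F 1 - F 0) {0..1}"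
    proof (rule fundamental_theorem_of_calculus)
      fix x :: real assume x: "x \<in> {0..1}"
      have "of_real x \<in> T" using x T by auto
      note hg = has_vector_derivative_holomorphic_of_real[OF g T(1) this]
      have hc: "((\<lambda>x. of_real (cos (w * x)) :: complex) has_vector_derivative of_real (- (w * sin (w * x)))) (at x within {0..1})"
        by (rule has_vector_derivative_of_real) (auto intro!: derivative_eq_intros)
      have "((\<lambda>x. - (g (of_real x) * of_real (cos (w * x))) / of_real w) has_vector_derivative
         - (g (of_real x) * of_real (- (w * sin (w * x))) + deriv g (of_real x) * of_real (cos (w * x))) / of_real w) (at x within {0..1})"
        by (intro has_vector_derivative_divide has_vector_derivative_minus has_vector_derivative_mult hg hc)
      also have "- (g (of_real x) * of_real (- (w * sin (w * x))) + deriv g (of_real x) * of_real (cos (w * x))) / of_real w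
        = g (of_real x) * of_real (sin (w * x)) - deriv g (of_real x) * of_real (cos (w * x)) / of_real w"
        using w by (simp add: field_simps)
      finally show "(F has_vector_derivative g (of_real x) * of_real (sin (w * x)) -
               deriv g (of_real x) * of_real (cos (w * x)) / of_real w) (at x within {0..1})"
        unfolding F_def .
    qed simp
    then have "integral {0..1} (\<lambda>x. g (of_real x) * of_real (sin (w * x))) =
        F 1 - F 0 + integral {0..1} (\<lambda>x. deriv g (of_real x) * of_real (cos (w * x))) / of_real w"
      using i1 i2 by (simp add: integral_diff integral_divide integrable_on_divide integral_unique[symmetric] algebra_simps
          has_integral_iff)
    also have "norm \<dots> \<le> norm (F 1) + norm (F 0) +
       norm (integral {0..1} (\<lambda>x. deriv g (of_real x) * of_real (cos (w * x))) / of_real w)"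
      by (meson norm_triangle_ineq norm_triangle_ineq4 order_trans add_right_mono)
    also have "norm (F 1) \<le> norm (g 1) / w" using w by (simp add: F_def norm_mult norm_divide divide_right_mono mult_left_le)
    also have "norm (F 0) = norm (g 0) / w" using w by (simp add: F_def norm_mult norm_divide)
    also have "norm (integral {0..1} (\<lambda>x. deriv g (of_real x) * of_real (cos (w * x)))) \<le> B * (1 - 0)"
    proof (rule integral_bound)
      fix x :: real assume x: "x \<in> {0..1}"
      have "norm (deriv g (of_real x)) * \<bar>cos (w * x)\<bar> \<le> B * 1"
        using B[OF x] order_trans[OF norm_ge_zero B[OF x]] by (intro mult_mono) auto
      then show "norm (deriv g (of_real x) * of_real (cos (w * x))) \<le> B" by (simp add: norm_mult)
    qed (auto intro!: continuous_intros cd)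
    then have "norm (integral {0..1} (\<lambda>x. deriv g (of_real x) * of_real (cos (w * x))) / of_real w) \<le> B / w"
      using w by (simp add: norm_divide divide_right_mono)
    finally have "norm (integral {0..1} (\<lambda>x. g (of_real x) * of_real (sin (w * x)))) \<le> C / w"
      by (simp add: C_def add_divide_distrib)
    then show ?thesis by (simp add: w_def mult_ac)
  qed
  then have "\<forall>\<^sub>F n in sequentially. norm (integral {0..1} (\<lambda>x. g (of_real x) * of_real (sin (2 * real n * pi * x)))) \<le> C / (2 * pi) * (1 / real n)"
    by (auto intro: eventually_mono[OF eventually_gt_at_top[of 0]])
  then show ?thesis
    by (rule Lim_null_comparison) real_asymp
qed

text \<open>The Dirichlet kernel for odd frequencies, kept in product form so that the zeros of sin
  t cause no exception.\<close>

lemma sum_cos_odd: "(\<Sum>k<n. cos (real (2 * k + 1) * t)) * (2 * sin t) = sin (2 * real n * t)"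
proof (induction n)
  case (Suc n)
  have "cos (real (2 * n + 1) * t) * (2 * sin t) = sin (2 * real (Suc n) * t) - sin (2 * real n * t)"
    using sin_add[of "real (2 * n + 1) * t" t] sin_diff[of "real (2 * n + 1) * t" t]
    by (simp add: algebra_simps)
  then show ?case using Suc by (simp add: distrib_right)
qed simp

text \<open>The boundary terms contain sin (w x), which vanishes at both ends.\<close>

lemma integral_cos_by_parts:
  assumes h: "h holomorphic_on T" and T: "open T" "of_real ` {0..1} \<subseteq> T" and w: "w \<noteq> 0" "sin w = 0"
  shows "integral {0..1} (\<lambda>x. h (of_real x) * of_real (cos (w * x))) =
           - (integral {0..1} (\<lambda>x. deriv h (of_real x) * of_real (sin (w * x))) / of_real w)"
proof -
  have ch: "continuous_on {0..1} (\<lambda>x. h (of_real x))"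
    by (rule continuous_on_compose2[OF holomorphic_on_imp_continuous_on[OF h]])
       (use T in \<open>auto intro!: continuous_intros\<close>)
  have "deriv h holomorphic_on T" using h T by (intro holomorphic_deriv)
  then have cd: "continuous_on {0..1} (\<lambda>x. deriv h (of_real x))"
    by (intro continuous_on_compose2[OF holomorphic_on_imp_continuous_on, of "deriv h" T])
       (use T in \<open>auto intro!: continuous_intros\<close>)
  define F where "F = (\<lambda>x. h (of_real x) * of_real (sin (w * x)) / of_real w)"
  have i1: "(\<lambda>x. deriv h (of_real x) * of_real (sin (w * x))) integrable_on {0..1}"
    by (intro integrable_continuous_interval continuous_intros cd)
  have i2: "(\<lambda>x. h (of_real x) * of_real (cos (w * x))) integrable_on {0..1}"
    by (intro integrable_continuous_interval continuous_intros ch)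
  have "((\<lambda>x. h (of_real x) * of_real (cos (w * x)) + deriv h (of_real x) * of_real (sin (w * x)) / of_real w)
           has_integral F 1 - F 0) {0..1}"
  proof (rule fundamental_theorem_of_calculus)
    fix x :: real assume x: "x \<in> {0..1}"
    have "of_real x \<in> T" using x T by auto
    note hg = has_vector_derivative_holomorphic_of_real[OF h T(1) this]
    have hc: "((\<lambda>x. of_real (sin (w * x)) :: complex) has_vector_derivative of_real (w * cos (w * x))) (at x within {0..1})"
      by (rule has_vector_derivative_of_real) (auto intro!: derivative_eq_intros)
    have "(F has_vector_derivative
       (h (of_real x) * of_real (w * cos (w * x)) + deriv h (of_real x) * of_real (sin (w * x))) / of_real w) (at x within {0..1})"
      unfolding F_def by (intro has_vector_derivative_divide has_vector_derivative_mult hg hc)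
    also have "(h (of_real x) * of_real (w * cos (w * x)) + deriv h (of_real x) * of_real (sin (w * x))) / of_real w
      = h (of_real x) * of_real (cos (w * x)) + deriv h (of_real x) * of_real (sin (w * x)) / of_real w"
      using w by (simp add: field_simps)
    finally show "(F has_vector_derivative h (of_real x) * of_real (cos (w * x)) +
             deriv h (of_real x) * of_real (sin (w * x)) / of_real w) (at x within {0..1})" .
  qed simp
  moreover have "F 1 - F 0 = 0" using w by (simp add: F_def)
  ultimately show ?thesis
    using i1 i2 by (simp add: has_integral_iff integral_add integral_divide integrable_on_divide eq_neg_iff_add_eq_0)
qed

lemma has_integral_cos_0:
  assumes "w \<noteq> 0" "sin w = 0"
  shows "((\<lambda>x. of_real (cos (w * x)) :: complex) has_integral 0) {0..1}"
proof -
  have "integral {0..1} (\<lambda>x. 1 * of_real (cos (w * x)) :: complex) =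
          - (integral {0..1} (\<lambda>x. deriv (\<lambda>_. 1) (of_real x) * of_real (sin (w * x))) / of_real w)"
    by (rule integral_cos_by_parts[where T = UNIV]) (use assms in auto)
  moreover have "(\<lambda>x. of_real (cos (w * x)) :: complex) integrable_on {0..1}"
    by (intro integrable_continuous_interval continuous_intros)
  ultimately show ?thesis by (simp add: has_integral_iff)
qed

lemma sin_nat_pi_mult: "sin (real n * pi) = 0"
  by (simp add: sin_zero_iff_int2)

lemma has_integral_cos_mult_cos_odd:
  "((\<lambda>x. of_real (cos (pi * x) * cos (real (2 * k + 1) * pi * x)) :: complex)
      has_integral (if k = 0 then 1 / 2 else 0)) {0..1}"
proof -
  have a: "((\<lambda>x. of_real (cos (real n * pi * x)) :: complex) has_integral (if n = 0 then 1 else 0)) {0..1}" for n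
    using has_integral_cos_0[of "real n * pi"] has_integral_const_real[of "1::complex" 0 1]
    by (auto simp: sin_nat_pi_mult)
  have "cos (pi * x) * cos (real (2 * k + 1) * pi * x) =
          (cos (real (2 * k) * pi * x) + cos (real (2 * k + 2) * pi * x)) / 2" for x
    using cos_add[of "real (2 * k + 1) * pi * x" "pi * x"] cos_diff[of "real (2 * k + 1) * pi * x" "pi * x"]
    by (simp add: algebra_simps)
  then have eq: "of_real (cos (pi * x) * cos (real (2 * k + 1) * pi * x)) =
        (of_real (cos (real (2 * k) * pi * x)) + of_real (cos (real (2 * k + 2) * pi * x)) :: complex) / 2" for x
    by (simp only: of_real_add of_real_divide of_real_numeral)
  show ?thesis unfolding eq
    using has_integral_divide[OF has_integral_add[OF a[of "2 * k"] a[of "2 * k + 2"]], of 2] by auto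
qed

text \<open>The partial sums are integrals of f (x) sin (2 n pi x) / (2 sin (pi x)). Vanishing of f
  at 0 and 1 makes f / sin holomorphic near [0, 1], and the Riemann-Lebesgue estimate
  applies.\<close>

lemma half_range_cosine_series_vanishing:
  assumes f: "f holomorphic_on S" and S: "open S" "of_real ` {0..1} \<subseteq> S" and z: "f 0 = 0" "f 1 = 0"
  shows "(\<lambda>k. integral {0..1} (\<lambda>x. f (of_real x) * of_real (cos (real (2 * k + 1) * pi * x)))) sums 0"
proof -
  obtain g T where g: "g holomorphic_on T" "open T" "of_real ` {0..1} \<subseteq> T"
    and fg: "\<And>x. x \<in> {0..1} \<Longrightarrow> f (of_real x) = g (of_real x) * of_real (sin (pi * x))"
    using holomorphic_divide_sin[OF f S z] by metis
  have cf: "continuous_on {0..1} (\<lambda>x. f (of_real x))"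
    by (rule continuous_on_compose2[OF holomorphic_on_imp_continuous_on[OF f]])
       (use S in \<open>auto intro!: continuous_intros\<close>)
  have "(\<Sum>k<n. integral {0..1} (\<lambda>x. f (of_real x) * of_real (cos (real (2 * k + 1) * pi * x)))) =
          integral {0..1} (\<lambda>x. g (of_real x) * of_real (sin (2 * real n * pi * x))) / 2" for n
  proof -
    have "(\<Sum>k<n. integral {0..1} (\<lambda>x. f (of_real x) * of_real (cos (real (2 * k + 1) * pi * x)))) =
        integral {0..1} (\<lambda>x. \<Sum>k<n. f (of_real x) * of_real (cos (real (2 * k + 1) * pi * x)))"
      by (rule integral_sum[symmetric]) (auto intro!: integrable_continuous_interval continuous_intros cf)
    also have "\<dots> = integral {0..1} (\<lambda>x. g (of_real x) * of_real (sin (2 * real n * pi * x)) / 2)"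
    proof (rule integral_cong)
      fix x :: real assume x: "x \<in> {0..1}"
      have "(\<Sum>k<n. f (of_real x) * of_real (cos (real (2 * k + 1) * pi * x))) =
          g (of_real x) * (of_real ((\<Sum>k<n. cos (real (2 * k + 1) * (pi * x))) * (2 * sin (pi * x))) / 2)"
        using fg[OF x] by (simp add: sum_distrib_left sum_distrib_right mult_ac)
      then show "(\<Sum>k<n. f (of_real x) * of_real (cos (real (2 * k + 1) * pi * x))) =
          g (of_real x) * of_real (sin (2 * real n * pi * x)) / 2"
        unfolding sum_cos_odd by (simp add: mult_ac)
    qed
    finally show ?thesis by (simp add: integral_divide)
  qed
  then show ?thesis
    unfolding sums_def using tendsto_divide[OF riemann_lebesgue_sin[OF g] tendsto_const[of 2]]
    by (simp only:) simp
qed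

lemma half_range_cosine_series:
  assumes h: "h holomorphic_on S" and S: "open S" "of_real ` {0..1} \<subseteq> S"
  shows "(\<lambda>k. integral {0..1} (\<lambda>x. h (of_real x) * of_real (cos (real (2 * k + 1) * pi * x)))) sums ((h 0 - h 1) / 4)"
proof -
  \<comment> \<open>Chosen so that h - A - B cos (pi z) vanishes at 0 and 1. The constant A has zero
    coefficient at every odd frequency, and cos (pi x) contributes only at k = 0, with coefficient
    1/2; hence the sum B / 2.\<close>
  define A B where "A = (h 0 + h 1) / 2" and "B = (h 0 - h 1) / 2"
  define f where "f = (\<lambda>z. h z - A - B * cos (of_real pi * z))"
  define I where "I = (\<lambda>k. integral {0..1} (\<lambda>x. f (of_real x) * of_real (cos (real (2 * k + 1) * pi * x))))"
  have f: "f holomorphic_on S" unfolding f_def by (intro holomorphic_intros h)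
  have cf: "continuous_on {0..1} (\<lambda>x. f (of_real x))"
    by (rule continuous_on_compose2[OF holomorphic_on_imp_continuous_on[OF f]])
       (use S in \<open>auto intro!: continuous_intros\<close>)
  have I: "I sums 0"
    unfolding I_def
    by (rule half_range_cosine_series_vanishing[OF f S])
       (simp_all add: f_def A_def B_def field_simps flip: cos_of_real)
  have "integral {0..1} (\<lambda>x. h (of_real x) * of_real (cos (real (2 * k + 1) * pi * x))) =
          I k + B * (if k = 0 then 1 / 2 else 0)" for k
  proof -
    have "((\<lambda>x. f (of_real x) * of_real (cos (real (2 * k + 1) * pi * x)) +
              (A * of_real (cos (real (2 * k + 1) * pi * x)) +
               B * of_real (cos (pi * x) * cos (real (2 * k + 1) * pi * x)))) has_integral
            I k + (A * 0 + B * (if k = 0 then 1 / 2 else 0))) {0..1}"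
      unfolding I_def
      by (intro has_integral_add has_integral_mult_right has_integral_cos_mult_cos_odd
          has_integral_cos_0 integrable_integral integrable_continuous_interval continuous_intros cf sin_nat_pi_mult) auto
    also have "(\<lambda>x. f (of_real x) * of_real (cos (real (2 * k + 1) * pi * x)) +
              (A * of_real (cos (real (2 * k + 1) * pi * x)) +
               B * of_real (cos (pi * x) * cos (real (2 * k + 1) * pi * x)))) =
        (\<lambda>x. h (of_real x) * of_real (cos (real (2 * k + 1) * pi * x)))"
      by (simp add: fun_eq_iff f_def algebra_simps flip: cos_of_real)
    finally show ?thesis by (simp add: integral_unique)
  qed
  moreover have "(\<lambda>k. I k + B * (if k = 0 then 1 / 2 else 0)) sums (0 + B * (1 / 2))"
    by (intro sums_add I sums_mult sums_single[of 0 "\<lambda>_. 1/2 :: complex"])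
  ultimately show ?thesis by (simp add: B_def)
qed

lemma sin_odd_pi: "sin (real (2 * k + 1) * pi) = 0"
  by (rule sin_nat_pi_mult)

lemma cos_odd_pi: "cos (real (2 * k + 1) * pi) = - 1"
  using cos_npi[of "2 * k + 1"] by (simp add: mult.commute)

lemma half_range_sine_series:
  assumes h: "h holomorphic_on S" and S: "open S" "of_real ` {0..1} \<subseteq> S"
  shows "(\<lambda>k. integral {0..1} (\<lambda>x. deriv h (of_real x) * of_real (sin (real (2 * k + 1) * pi * x))) / of_real (real (2 * k + 1) * pi))
           sums ((h 1 - h 0) / 4)"
proof -
  have "integral {0..1} (\<lambda>x. deriv h (of_real x) * of_real (sin (real (2 * k + 1) * pi * x))) / of_real (real (2 * k + 1) * pi)
     = - integral {0..1} (\<lambda>x. h (of_real x) * of_real (cos (real (2 * k + 1) * pi * x)))" for k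
    by (subst integral_cos_by_parts[OF h S _ sin_odd_pi]) auto
  moreover have "(\<lambda>k. - integral {0..1} (\<lambda>x. h (of_real x) * of_real (cos (real (2 * k + 1) * pi * x)))) sums (- ((h 0 - h 1) / 4))"
    by (intro sums_minus half_range_cosine_series[OF h S])
  ultimately show ?thesis by (simp only: minus_divide_left minus_diff_eq)
qed

text \<open>The sine series for h z = z: each integral of sin (w x) equals 2 / w since cos w = -1,
  so the values 2 / w^2 add up to 1/4.\<close>

lemma odd_inverse_squares_sums: "(\<lambda>k. 1 / (of_real (real (2 * k + 1) * pi) :: complex)\<^sup>2) sums (1 / 8)"
proof -
  have "integral {0..1} (\<lambda>x. of_real (sin (real (2 * k + 1) * pi * x))) = (2 / of_real (real (2 * k + 1) * pi) :: complex)" for k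
  proof -
    define w where "w = real (2 * k + 1) * pi"
    have w: "w \<noteq> 0" "cos w = - 1" unfolding w_def using cos_odd_pi by auto
    have "((\<lambda>x. of_real (sin (w * x)) :: complex) has_integral of_real (- cos (w * 1) / w) - of_real (- cos (w * 0) / w)) {0..1}"
      by (rule fundamental_theorem_of_calculus)
        (use w in \<open>auto intro!: derivative_eq_intros has_vector_derivative_of_real\<close>)
    then have "integral {0..1} (\<lambda>x. of_real (sin (w * x))) = (2 / of_real w :: complex)"
      using w by (simp add: integral_unique field_simps)
    then show ?thesis by (simp only: w_def)
  qed
  then have "(\<lambda>k. 2 / of_real (real (2 * k + 1) * pi) / (of_real (real (2 * k + 1) * pi) :: complex)) sums ((1 - 0) / 4)"
    using half_range_sine_series[of "\<lambda>z. z" UNIV] by (simp del: of_real_mult of_real_of_nat_eq)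
  from sums_divide[OF this, of 2] show ?thesis
    by (simp add: power2_eq_square)
qed

section \<open>The series in the expansion\<close>


text \<open>Value of \<open>scaled_Gamma p\<close> at the logarithm of \<open>w q exp (- e i \<pi> / 2)\<close>, where \<open>e = \<plusminus>1\<close>.\<close>

definition ray_Gamma :: "real \<Rightarrow> real \<Rightarrow> complex \<Rightarrow> complex \<Rightarrow> complex" where
  "ray_Gamma e w q p = scaled_Gamma p (Ln q + of_real (ln w) - of_real (e * pi / 2) * \<i>)"

lemma Pi_term_eq_ray_Gamma:
  assumes "q \<noteq> 0" "w > 0"
  shows "Pi_term p (of_real w * q) = (ray_Gamma (- 1) w q p + ray_Gamma 1 w q p) / 2"
proof -
  have "Ln (of_real w * q) = of_real (ln w) + Ln q" using assms Ln_times_of_real[of w q] by (simp add: Ln_of_real)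
  then show ?thesis
    using assms by (simp add: Pi_term_eq ray_Gamma_def add_ac)
qed

lemma ray_Gamma_rec:
  assumes "q \<noteq> 0" "w > 0" "\<bar>e\<bar> = 1"
  shows "ray_Gamma e w q p = 1 + p / (\<i> * of_real (e * w) * q) * ray_Gamma e w q (p + 1)"
proof -
  have "exp (Ln q + of_real (ln w) - of_real (e * pi / 2) * \<i>) = q * of_real w / (of_real e * \<i>)"
    using assms exp_signed_half_pi_ii[OF assms(3)] by (simp add: exp_diff exp_add exp_of_real)
  also have "\<dots> = - (\<i> * of_real (e * w) * q)"
    using assms by (auto simp: field_simps abs_if split: if_splits)
  finally show ?thesis
    unfolding ray_Gamma_def by (subst scaled_Gamma_rec) simp
qed

lemma ray_Gamma_eq_osc_integral:
  assumes "q \<notin> \<real>\<^sub>\<le>\<^sub>0" "w > 0" "\<bar>e\<bar> = 1" "Re p > 1"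
  shows "ray_Gamma e w q p = - (\<i> * of_real (e * w)) * q powr p * osc_integral (\<i> * of_real (e * w)) q p"
  unfolding ray_Gamma_def by (rule scaled_Gamma_eq_osc_integral[OF assms])

text \<open>One step of the recurrence enlarges the range to Re p > 0 and cancels the prefactor w of
  the previous formula, so that the right side is bounded uniformly in w.\<close>

lemma ray_Gamma_eq_osc_integral':
  assumes "q \<notin> \<real>\<^sub>\<le>\<^sub>0" "w > 0" "\<bar>e\<bar> = 1" "Re p > 0"
  shows "ray_Gamma e w q p = 1 - p * q powr p * osc_integral (\<i> * of_real (e * w)) q (p + 1)"
proof -
  have "q \<noteq> 0" "e \<noteq> 0" using assms by auto
  then show ?thesis
    using assms by (simp add: ray_Gamma_rec[of q w e p] ray_Gamma_eq_osc_integral powr_add field_simps)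
qed

text \<open>The integral representation covers \<open>Re p > 0\<close>; the recurrence carries holomorphy and bounds to
  the left, one unit strip at a time.\<close>

lemma holomorphic_ray_Gamma:
  assumes q: "q \<notin> \<real>\<^sub>\<le>\<^sub>0" and w: "w > 0" and e: "\<bar>e\<bar> = 1"
  shows "ray_Gamma e w q holomorphic_on UNIV"
proof -
  have q0: "q \<noteq> 0" "e \<noteq> 0" "w \<noteq> 0" using assms by auto
  have open_half: "open {p. Re p > c}" for c by (rule open_halfspace_Re_gt)
  have hol: "ray_Gamma e w q holomorphic_on {p. Re p > - real m}" for m
  proof (induction m)
    case 0
    have "(\<lambda>p. 1 - p * q powr p * osc_integral (\<i> * of_real (e * w)) q (p + 1)) holomorphic_on {p. Re p > - real 0}"
      by (intro holomorphic_intros holomorphic_on_compose_gen[OF _ holomorphic_osc_integral[OF q], unfolded o_def])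
        (use q0 in auto)
    then show ?case
      by (rule holomorphic_transform) (use ray_Gamma_eq_osc_integral'[OF q w e] in auto)
  next
    case (Suc m)
    have "(\<lambda>p. 1 + p / (\<i> * of_real (e * w) * q) * ray_Gamma e w q (p + 1)) holomorphic_on {p. Re p > - real (Suc m)}"
      by (intro holomorphic_intros holomorphic_on_compose_gen[OF _ Suc.IH, unfolded o_def])
        (use q0 in auto)
    then show ?case
      by (rule holomorphic_transform) (rule ray_Gamma_rec[OF q0(1) w e, symmetric])
  qed
  show ?thesis
    unfolding holomorphic_on_def
  proof
    fix z :: complex
    obtain m where "real m > - Re z" using reals_Archimedean2 by blast
    then have "z \<in> {p. Re p > - real m}" by auto
    with hol[of m] open_half show "ray_Gamma e w q field_differentiable at z within UNIV"
      using holomorphic_on_imp_differentiable_at by blast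
  qed
qed

text \<open>Uniformity in w survives the induction: in the base case w enters only as a frequency,
  and each step to the left multiplies by p / (w q), where 1 / w is at most 1.\<close>

lemma ray_Gamma_locally_bounded:
  assumes q: "q \<notin> \<real>\<^sub>\<le>\<^sub>0" and e: "\<bar>e\<bar> = 1"
  shows "\<exists>d>0. \<exists>M. \<forall>p\<in>cball z d. \<forall>w\<ge>1. norm (ray_Gamma e w q p) \<le> M"
proof -
  have q0: "q \<noteq> 0" using q by auto
  have norm_p: "norm p \<le> norm z + d" if "p \<in> cball z d" for p z d
    using that norm_triangle_sub[of p z] by (auto simp: dist_norm norm_minus_commute)
  have main: "\<exists>d>0. \<exists>M. \<forall>p\<in>cball z d. \<forall>w\<ge>1. norm (ray_Gamma e w q p) \<le> M" if "Re z > - real m" for z m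
    using that
  proof (induction m arbitrary: z)
    case 0
    define d where "d = Re z / 2"
    have d: "d > 0" "Re z - d = d" using 0 by (auto simp: d_def)
    have r0: "0 \<le> 1 + d" using d by simp
    obtain K where K: "0 < K" "\<And>p x. 1 + d \<le> Re p \<Longrightarrow> Re p \<le> Re z + 1 + d \<Longrightarrow> \<bar>Im p\<bar> \<le> \<bar>Im z\<bar> + d \<Longrightarrow> x \<ge> 0 \<Longrightarrow>
         norm ((q + of_real x) powr - p) \<le> K * (1 + x) powr - (1 + d)"
      by (rule slit_plane_powr_decay[OF q r0, of "Re z + 1 + d" "\<bar>Im z\<bar> + d"]) (rule that, assumption, blast)
    have "bounded ((\<lambda>p. q powr p) ` cball z d)"
      unfolding powr_def using q0
      by (intro compact_imp_bounded compact_continuous_image compact_cball) (auto intro!: continuous_intros)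
    then obtain Q where Q: "\<And>p. p \<in> cball z d \<Longrightarrow> norm (q powr p) \<le> Q"
      unfolding bounded_iff by blast
    have Q0: "Q \<ge> 0" using Q[of z] d by (metis centre_in_cball less_le norm_ge_zero order_trans)
    have "norm (ray_Gamma e w q p) \<le> 1 + (norm z + d) * Q * (K * (1 / d))"
      if p: "p \<in> cball z d" and w: "w \<ge> 1" for p w
    proof -
      have "\<bar>Re (z - p)\<bar> \<le> d" "\<bar>Im (z - p)\<bar> \<le> d"
        using p abs_Re_le_cmod[of "z - p"] abs_Im_le_cmod[of "z - p"] by (auto simp: dist_norm)
      then have ball: "1 + d \<le> Re (p + 1)" "Re (p + 1) \<le> Re z + 1 + d" "\<bar>Im (p + 1)\<bar> \<le> \<bar>Im z\<bar> + d"
        using d by auto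
      have "norm (osc_integral (\<i> * of_real (e * w)) q (p + 1)) \<le> K * (1 / d)"
      proof (rule osc_integral_norm_le[OF q])
        show "((\<lambda>x. K * (1 + x) powr - (1 + d)) has_integral K * (1 / d)) {0..}"
          using has_integral_mult_right[OF has_integral_add_powr_to_inf[of 1 "1 + d"], of K] d by simp
        show "norm ((q + of_real x) powr - (p + 1)) \<le> K * (1 + x) powr - (1 + d)" if "x \<ge> 0" for x
          by (rule K(2)[OF ball that])
      qed (use ball d in auto)
      then have "norm (p * q powr p * osc_integral (\<i> * of_real (e * w)) q (p + 1)) \<le> (norm z + d) * Q * (K * (1 / d))"
        unfolding norm_mult using norm_p[OF p] Q[OF p] Q0 d by (intro mult_mono) auto
      moreover have "ray_Gamma e w q p = 1 - p * q powr p * osc_integral (\<i> * of_real (e * w)) q (p + 1)"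
        by (rule ray_Gamma_eq_osc_integral'[OF q _ e]) (use w ball d in auto)
      ultimately show ?thesis
        using norm_triangle_ineq4[of 1 "p * q powr p * osc_integral (\<i> * of_real (e * w)) q (p + 1)"] by simp
    qed
    with d show ?case by blast
  next
    case (Suc m)
    have "Re (z + 1) > - real m" using Suc.prems by simp
    from Suc.IH[OF this] obtain d M where d: "d > 0"
      and M: "\<And>p w. p \<in> cball (z + 1) d \<Longrightarrow> w \<ge> 1 \<Longrightarrow> norm (ray_Gamma e w q p) \<le> M" by blast
    have "norm (ray_Gamma e w q p) \<le> 1 + (norm z + d) / norm q * M" if p: "p \<in> cball z d" and w: "w \<ge> 1" for p w
    proof -
      have M': "norm (ray_Gamma e w q (p + 1)) \<le> M" using M[OF _ w] p by (simp add: dist_norm)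
      have "norm (p / (\<i> * of_real (e * w) * q)) = norm p / (w * norm q)"
        using e w by (simp add: norm_divide norm_mult abs_mult)
      also have "\<dots> \<le> (norm z + d) / (1 * norm q)"
        using norm_p[OF p] w d q0 by (intro frac_le mult_right_mono) auto
      finally have "norm (p / (\<i> * of_real (e * w) * q) * ray_Gamma e w q (p + 1)) \<le> (norm z + d) / norm q * M"
        unfolding norm_mult using M' d by (intro mult_mono) auto
      moreover have "ray_Gamma e w q p = 1 + p / (\<i> * of_real (e * w) * q) * ray_Gamma e w q (p + 1)"
        by (rule ray_Gamma_rec) (use q0 w e in auto)
      ultimately show ?thesis
        using norm_triangle_ineq[of 1 "p / (\<i> * of_real (e * w) * q) * ray_Gamma e w q (p + 1)"] by simp
    qed
    with d show ?case by blast
  qed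
  obtain m where "real m > - Re z" using reals_Archimedean2 by blast
  then show ?thesis by (intro main[of m]) auto
qed

section \<open>The series over the odd multiples of pi\<close>

definition odd_pi :: "nat \<Rightarrow> real" where
  "odd_pi k = real (2 * k + 1) * pi"

lemma odd_pi_ge_1: "odd_pi k \<ge> 1"
proof -
  have "1 * 1 \<le> real (2 * k + 1) * pi" using pi_ge_two by (intro mult_mono) auto
  then show ?thesis by (simp add: odd_pi_def)
qed

lemma odd_pi_pos [simp]: "odd_pi k > 0" "odd_pi k \<noteq> 0"
  using odd_pi_ge_1[of k] by linarith+

lemma odd_pi_inverse_squares_sums: "(\<lambda>k. 1 / (odd_pi k)\<^sup>2) sums (1 / 8)"
proof -
  have "(\<lambda>k. of_real (1 / (odd_pi k)\<^sup>2) :: complex) sums of_real (1 / 8)"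
    using odd_inverse_squares_sums by (simp add: odd_pi_def)
  then show ?thesis by (simp only: sums_of_real_iff)
qed

definition Pi_series :: "complex \<Rightarrow> complex \<Rightarrow> complex" where
  "Pi_series s q = (\<Sum>k. Pi_term (s + 1) (of_real (odd_pi k) * q) / of_real (odd_pi k) ^ 2)"

text \<open>The function R(s, q): what remains of the expansion once its terms have been reduced and
  the constant 1/8 has been summed.\<close>

definition alt_zeta_rhs :: "complex \<Rightarrow> complex \<Rightarrow> complex" where
  "alt_zeta_rhs s q = q powr - s / 2 + 2 * s * q powr (- s - 1) * Pi_series s q"

lemma Pi_series_properties:
  assumes q: "q \<notin> \<real>\<^sub>\<le>\<^sub>0"
  shows summable_Pi_series: "summable (\<lambda>k. Pi_term (s + 1) (of_real (odd_pi k) * q) / of_real (odd_pi k) ^ 2)"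
    and holomorphic_Pi_series: "(\<lambda>s. Pi_series s q) holomorphic_on UNIV"
proof -
  have q0: "q \<noteq> 0" using q by auto
  define f where "f = (\<lambda>k s. Pi_term (s + 1) (of_real (odd_pi k) * q) / of_real (odd_pi k) ^ 2)"
  have f_eq: "f k s = (ray_Gamma (- 1) (odd_pi k) q (s + 1) + ray_Gamma 1 (odd_pi k) q (s + 1)) / 2 / of_real (odd_pi k) ^ 2" for k s
    using q0 by (simp add: f_def Pi_term_eq_ray_Gamma)
  have summ: "summable (\<lambda>k. 1 / (odd_pi k)\<^sup>2)" using odd_pi_inverse_squares_sums by (rule sums_summable)
  have bound: "\<exists>d>0. \<exists>M. \<forall>s\<in>cball z d. \<forall>k. norm (f k s) \<le> M * (1 / (odd_pi k)\<^sup>2)" for z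
  proof -
    have bdd1: "\<exists>d>0. \<exists>M. \<forall>p\<in>cball (z + 1) d. \<forall>w\<ge>1. norm (ray_Gamma 1 w q p) \<le> M"
      by (rule ray_Gamma_locally_bounded[OF q]) simp
    obtain d1 M1 where d1: "d1 > 0"
      and M1: "\<And>p w. p \<in> cball (z + 1) d1 \<Longrightarrow> w \<ge> 1 \<Longrightarrow> norm (ray_Gamma 1 w q p) \<le> M1"
      using bdd1 by blast
    have bdd2: "\<exists>d>0. \<exists>M. \<forall>p\<in>cball (z + 1) d. \<forall>w\<ge>1. norm (ray_Gamma (- 1) w q p) \<le> M"
      by (rule ray_Gamma_locally_bounded[OF q]) simp
    obtain d2 M2 where d2: "d2 > 0"
      and M2: "\<And>p w. p \<in> cball (z + 1) d2 \<Longrightarrow> w \<ge> 1 \<Longrightarrow> norm (ray_Gamma (- 1) w q p) \<le> M2"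
      using bdd2 by blast
    have "norm (f k s) \<le> ((M1 + M2) / 2) * (1 / (odd_pi k)\<^sup>2)" if s: "s \<in> cball z (min d1 d2)" for k s
    proof -
      have "norm (ray_Gamma (- 1) (odd_pi k) q (s + 1) + ray_Gamma 1 (odd_pi k) q (s + 1)) \<le> M2 + M1"
        using s by (intro norm_triangle_mono M1 M2 odd_pi_ge_1) (auto simp: dist_norm)
      then show ?thesis
        by (simp add: f_eq norm_divide norm_power divide_right_mono add.commute)
    qed
    then have "\<forall>s\<in>cball z (min d1 d2). \<forall>k. norm (f k s) \<le> ((M1 + M2) / 2) * (1 / (odd_pi k)\<^sup>2)"
      by blast
    moreover have "min d1 d2 > 0" using d1 d2 by simp
    ultimately show ?thesis by blast
  qed
  have summ_f: "summable (\<lambda>k. f k s)" for s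
  proof -
    obtain d M where "d > 0" and M: "\<And>s' k. s' \<in> cball s d \<Longrightarrow> norm (f k s') \<le> M * (1 / (odd_pi k)\<^sup>2)"
      using bound[of s] by blast
    then have "\<And>k. norm (f k s) \<le> M * (1 / (odd_pi k)\<^sup>2)" by simp
    then show ?thesis
      by (intro summable_comparison_test'[OF summable_mult[OF summ, of M]]) auto
  qed
  then show "summable (\<lambda>k. Pi_term (s + 1) (of_real (odd_pi k) * q) / of_real (odd_pi k) ^ 2)"
    by (simp add: f_def)
  have "(\<lambda>s. \<Sum>k. f k s) holomorphic_on UNIV"
  proof (rule holomorphic_uniform_sequence[OF open_UNIV])
    have "(\<lambda>s. ray_Gamma e (odd_pi k) q (s + 1)) holomorphic_on UNIV" if "\<bar>e\<bar> = 1" for e k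
      by (rule holomorphic_on_compose_gen[OF _ holomorphic_ray_Gamma[OF q _ that], unfolded o_def])
         (auto intro!: holomorphic_intros)
    then show "(\<lambda>s. \<Sum>k<n. f k s) holomorphic_on UNIV" for n
      unfolding f_eq by (intro holomorphic_intros) auto
    fix z :: complex
    obtain d M where "d > 0" "\<And>s k. s \<in> cball z d \<Longrightarrow> norm (f k s) \<le> M * (1 / (odd_pi k)\<^sup>2)"
      using bound[of z] by blast
    then have "uniform_limit (cball z d) (\<lambda>n s. \<Sum>k<n. f k s) (\<lambda>s. \<Sum>k. f k s) sequentially"
      by (intro Weierstrass_m_test[OF _ summable_mult[OF summ, of M]]) auto
    with \<open>d > 0\<close> show "\<exists>d>0. cball z d \<subseteq> UNIV \<and>
        uniform_limit (cball z d) (\<lambda>n s. \<Sum>k<n. f k s) (\<lambda>s. \<Sum>k. f k s) sequentially"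
      by auto
  qed
  then show "(\<lambda>s. Pi_series s q) holomorphic_on UNIV"
    by (simp add: Pi_series_def f_def)
qed


text \<open>Shifting the oscillatory integrals by 1 changes the sign of the exponential, so only integrals over
  \<open>[0, 1]\<close> remain; these are Fourier coefficients of \<open>(q + x) powr - s\<close>.\<close>

lemma alt_zeta_rhs_plus1:
  assumes q: "q \<notin> \<real>\<^sub>\<le>\<^sub>0" and s: "Re s > 0"
  shows "alt_zeta_rhs s q + alt_zeta_rhs s (q + 1) = q powr - s"
proof -
  have q1: "q + 1 \<notin> \<real>\<^sub>\<le>\<^sub>0" using add_of_real_notin_nonpos_Reals[OF q, of 1] by simp
  define I where "I = (\<lambda>e k q. osc_integral (\<i> * of_real (e * odd_pi k)) q (s + 1))"
  \<comment> \<open>The k-th term with the prefactor 2 s q^(-s-1) included; this cancels the power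
    q^(s+1) of the integral representation, so the dependence on q lies in the integrals
    only.\<close>
  define U where "U = (\<lambda>q k. - (\<i> * s / of_real (odd_pi k)) * (I 1 k q - I (- 1) k q))"
  have U: "U q sums (2 * s * q powr (- s - 1) * Pi_series s q)" if q: "q \<notin> \<real>\<^sub>\<le>\<^sub>0" for q
  proof -
    have q0: "q \<noteq> 0" using q by auto
    have "2 * s * q powr (- s - 1) * (Pi_term (s + 1) (of_real (odd_pi k) * q) / of_real (odd_pi k) ^ 2) = U q k" for k
    proof -
      have "Pi_term (s + 1) (of_real (odd_pi k) * q) =
              - (\<i> * of_real (odd_pi k) / 2) * q powr (s + 1) * (I 1 k q - I (- 1) k q)"
        unfolding Pi_term_eq_ray_Gamma[OF q0 odd_pi_pos(1)]
        using s by (simp add: ray_Gamma_eq_osc_integral[OF q] I_def field_simps)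
      moreover have "q powr (- s - 1) * q powr (s + 1) = 1"
        using q0 by (simp flip: powr_add)
      then have "2 * s * q powr (- s - 1) * (- (\<i> * w / 2) * q powr (s + 1) * X / w ^ 2) = - (\<i> * s / w) * X"
        if "w \<noteq> 0" for w X
        using that by (simp add: field_simps power2_eq_square)
      from this[of "of_real (odd_pi k)"] have
        "2 * s * q powr (- s - 1) * (- (\<i> * of_real (odd_pi k) / 2) * q powr (s + 1) * (I 1 k q - I (- 1) k q)
           / of_real (odd_pi k) ^ 2) = U q k" by (simp add: U_def)
      ultimately show ?thesis by simp
    qed
    then show ?thesis
      using sums_mult[OF summable_sums[OF summable_Pi_series[OF q, of s]], of "2 * s * q powr (- s - 1)"]
      by (simp add: Pi_series_def)
  qed
  define h where "h = (\<lambda>z. (q + z) powr - s)"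
  define S where "S = {z. q + z \<notin> \<real>\<^sub>\<le>\<^sub>0}"
  have S: "open S" "of_real ` {0..1} \<subseteq> S"
  proof -
    have "S = (\<lambda>z. q + z) -` (- \<real>\<^sub>\<le>\<^sub>0)" by (auto simp: S_def)
    also have "open \<dots>"
      by (intro open_vimage continuous_intros) (simp add: open_Compl closed_nonpos_Reals_complex)
    finally show "open S" .
    show "of_real ` {0..1} \<subseteq> S" using add_of_real_notin_nonpos_Reals(1)[OF q] by (auto simp: S_def)
  qed
  have dh: "(h has_field_derivative - s * (q + z) powr (- s - 1)) (at z)" if "z \<in> S" for z
    unfolding h_def using that by (auto intro!: derivative_eq_intros simp: S_def)
  then have hol: "h holomorphic_on S"
    using S(1) by (auto simp: holomorphic_on_open)
  have "U q k + U (q + 1) k = - 2 *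
      (integral {0..1} (\<lambda>x. deriv h (of_real x) * of_real (sin (real (2 * k + 1) * pi * x))) / of_real (real (2 * k + 1) * pi))" for k
  proof -
    have "cis (odd_pi k) = -1"
      using cos_odd_pi[of k] sin_odd_pi[of k] by (simp only: complex_eq_iff cis.sel odd_pi_def) simp
    then have "exp (\<i> * of_real (odd_pi k)) = -1" by (simp only: cis_conv_exp)
    then have ex: "exp (\<i> * of_real (e * odd_pi k)) = -1" if "e = 1 \<or> e = -1" for e
      using that by (auto simp: exp_minus)
    have J: "I e k q + I e k (q + 1) = integral {0..1} (\<lambda>x. (q + of_real x) powr - (s + 1) * exp (\<i> * of_real (e * odd_pi k) * of_real x))"
      if "e = 1 \<or> e = -1" for e
      unfolding I_def using s ex[OF that]
      by (subst osc_integral_shift[OF q]) auto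
    have int: "(\<lambda>x. (q + of_real x) powr - (s + 1) * exp (c * of_real x)) integrable_on {0..1}" for c
      by (intro integrable_continuous_interval continuous_on_subset[OF continuous_on_osc_integrand[OF q]]) auto
    have "(I 1 k q + I 1 k (q + 1)) - (I (- 1) k q + I (- 1) k (q + 1)) =
      integral {0..1} (\<lambda>x. (q + of_real x) powr - (s + 1) * exp (\<i> * of_real (1 * odd_pi k) * of_real x) -
         (q + of_real x) powr - (s + 1) * exp (\<i> * of_real (- 1 * odd_pi k) * of_real x))"
      by (simp only: J disj_ac simp_thms integral_diff[OF int int])
    also have "\<dots> = integral {0..1} (\<lambda>x. - (2 * \<i> / s) * (deriv h (of_real x) * of_real (sin (odd_pi k * x))))"
    proof (rule integral_cong)
      fix x :: real assume "x \<in> {0..1}"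
      then have "of_real x \<in> S" using S by auto
      from DERIV_imp_deriv[OF dh[OF this]]
      have d: "deriv h (of_real x) = - s * (q + of_real x) powr - (s + 1)" by simp
      have "exp (\<i> * of_real (1 * odd_pi k) * of_real x) - exp (\<i> * of_real (- 1 * odd_pi k) * of_real x)
          = 2 * \<i> * of_real (sin (odd_pi k * x))"
      proof -
        have "\<i> * of_real (1 * odd_pi k) * of_real x = \<i> * of_real (odd_pi k * x)"
          "\<i> * of_real (- 1 * odd_pi k) * of_real x = \<i> * of_real (- (odd_pi k * x))" by simp_all
        then show ?thesis by (simp only: exp_Euler cos_of_real sin_of_real) (simp add: complex_eq_iff)
      qed
      moreover have "s \<noteq> 0" using s by auto
      moreover have "P * E1 - P * E2 = - (2 * \<i> / s) * (- s * P * X)"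
        if "E1 - E2 = 2 * \<i> * X" "s \<noteq> 0" for P E1 E2 X
        using that by (simp add: algebra_simps flip: right_diff_distrib)
      ultimately show "(q + of_real x) powr - (s + 1) * exp (\<i> * of_real (1 * odd_pi k) * of_real x) -
         (q + of_real x) powr - (s + 1) * exp (\<i> * of_real (- 1 * odd_pi k) * of_real x) =
         - (2 * \<i> / s) * (deriv h (of_real x) * of_real (sin (odd_pi k * x)))"
        unfolding d by blast
    qed
    finally have eq: "(I 1 k q + I 1 k (q + 1)) - (I (- 1) k q + I (- 1) k (q + 1)) =
        - (2 * \<i> / s) * integral {0..1} (\<lambda>x. deriv h (of_real x) * of_real (sin (odd_pi k * x)))"
      by simp
    have "U q k + U (q + 1) k = - (\<i> * s / of_real (odd_pi k)) * ((I 1 k q + I 1 k (q + 1)) - (I (- 1) k q + I (- 1) k (q + 1)))"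
      by (simp add: U_def algebra_simps)
    also have "\<dots> = - 2 * (integral {0..1} (\<lambda>x. deriv h (of_real x) * of_real (sin (odd_pi k * x))) / of_real (odd_pi k))"
      unfolding eq using s by (auto simp: field_simps)
    finally show ?thesis by (simp only: odd_pi_def)
  qed
  then have "(\<lambda>k. U q k + U (q + 1) k) sums (- 2 * ((h 1 - h 0) / 4))"
    using sums_mult[OF half_range_sine_series[OF hol S], of "- 2"] by simp
  moreover have "(\<lambda>k. U q k + U (q + 1) k) sums
      (2 * s * q powr (- s - 1) * Pi_series s q + 2 * s * (q + 1) powr (- s - 1) * Pi_series s (q + 1))"
    by (intro sums_add U q q1)
  ultimately have "2 * s * q powr (- s - 1) * Pi_series s q + 2 * s * (q + 1) powr (- s - 1) * Pi_series s (q + 1)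
      = - 2 * ((h 1 - h 0) / 4)" by (rule sums_unique2[symmetric])
  \<comment> \<open>The series contribute (q^(-s) - (q + 1)^(-s)) / 2, which together with the two
    leading halves leaves q^(-s).\<close>
  then show ?thesis by (simp add: alt_zeta_rhs_def h_def field_simps)
qed

text \<open>The leading term decays like n^(-Re s). In the series each ray value times Q^(-s-1),
  where Q = q + n, is O(1/n) uniformly in k, and the weights 1 / w^2 sum to 1/8.\<close>

lemma alt_zeta_rhs_tendsto_0:
  assumes q: "q \<notin> \<real>\<^sub>\<le>\<^sub>0" and s: "Re s > 0"
  shows "(\<lambda>n. alt_zeta_rhs s (q + of_nat n)) \<longlonglongrightarrow> 0"
proof -
  have decay: "\<exists>K>0. \<forall>x\<ge>0. norm ((q + of_real x) powr - p) \<le> K * (1 + x) powr - r" if "0 \<le> r" "r \<le> Re p" for p r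
  proof (rule slit_plane_powr_decay[OF q that(1), of "Re p" "\<bar>Im p\<bar>"])
    fix K assume "0 < K" "\<And>p' x. r \<le> Re p' \<Longrightarrow> Re p' \<le> Re p \<Longrightarrow> \<bar>Im p'\<bar> \<le> \<bar>Im p\<bar> \<Longrightarrow> x \<ge> 0 \<Longrightarrow>
      norm ((q + of_real x) powr - p') \<le> K * (1 + x) powr - r"
    then show ?thesis using that by blast
  qed
  obtain K0 where K0: "K0 > 0" "\<And>x. x \<ge> 0 \<Longrightarrow> norm ((q + of_real x) powr - s) \<le> K0 * (1 + x) powr - Re s"
    using decay[of "Re s" s] s less_imp_le by blast
  \<comment> \<open>The rates 1 and 2 are weaker than Re s + 1 and Re s + 2 but enough: integrating
    (1 + n + x)^(-2) over x gives (1 + n)^(-1), matching the term with \<open>K1\<close>.\<close>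
  obtain K1 where K1: "K1 > 0" "\<And>x. x \<ge> 0 \<Longrightarrow> norm ((q + of_real x) powr - (s + 1)) \<le> K1 * (1 + x) powr - 1"
    using decay[of 1 "s + 1"] s by (simp only: plus_complex.sel one_complex.sel) force
  obtain K2 where K2: "K2 > 0" "\<And>x. x \<ge> 0 \<Longrightarrow> norm ((q + of_real x) powr - (s + 1 + 1)) \<le> K2 * (1 + x) powr - 2"
    using decay[of 2 "s + 1 + 1"] s by (simp only: plus_complex.sel one_complex.sel) force
  define C where "C = K1 + norm (s + 1) * K2"
  have Cb: "norm (2 * s * (q + of_nat n) powr (- s - 1) * Pi_series s (q + of_nat n)) \<le> norm s * C / 4 * (1 + real n) powr - 1" for n
  proof -
    define Q where "Q = q + of_nat n"
    have Q: "Q \<notin> \<real>\<^sub>\<le>\<^sub>0" "Q \<noteq> 0"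
      using add_of_real_notin_nonpos_Reals[OF q, of "real n"] by (simp_all add: Q_def)
    have r: "norm (Q powr - (s + 1) * ray_Gamma e (odd_pi k) Q (s + 1)) \<le> C * (1 + real n) powr - 1" if e: "\<bar>e\<bar> = 1" for e k
    proof -
      let ?c = "\<i> * of_real (e * odd_pi k)"
      have "norm (osc_integral ?c Q (s + 1 + 1)) \<le> K2 * ((1 + real n) powr (1 - 2) / (2 - 1))"
      proof (rule osc_integral_norm_le[OF Q(1)])
        show "((\<lambda>x. K2 * ((1 + real n) + x) powr - 2) has_integral K2 * ((1 + real n) powr (1 - 2) / (2 - 1))) {0..}"
          by (intro has_integral_mult_right has_integral_add_powr_to_inf) auto
        show "norm ((Q + of_real x) powr - (s + 1 + 1)) \<le> K2 * ((1 + real n) + x) powr - 2" if "x \<ge> 0" for x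
          using K2(2)[of "real n + x"] that by (simp add: Q_def add_ac)
      qed (use s in auto)
      then have 2: "norm (osc_integral ?c Q (s + 1 + 1)) \<le> K2 * (1 + real n) powr - 1" by simp
      have 1: "norm (Q powr - (s + 1)) \<le> K1 * (1 + real n) powr - 1"
        using K1(2)[of "real n"] by (simp add: Q_def)
      \<comment> \<open>Cancelling the powers before taking norms keeps the growing factor Q^(s+1)
        out of the estimate.\<close>
      have "Q powr - (s + 1) * Q powr (s + 1) = 1" using Q by (simp flip: powr_add)
      then have "Q powr - (s + 1) * ray_Gamma e (odd_pi k) Q (s + 1) =
          Q powr - (s + 1) - (s + 1) * osc_integral ?c Q (s + 1 + 1)"
        using s by (subst ray_Gamma_eq_osc_integral'[OF Q(1) _ e]) (simp_all add: right_diff_distrib)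
      also have "norm \<dots> \<le> norm (Q powr - (s + 1)) + norm (s + 1) * norm (osc_integral ?c Q (s + 1 + 1))"
        by (metis norm_mult norm_triangle_ineq4)
      also have "\<dots> \<le> K1 * (1 + real n) powr - 1 + norm (s + 1) * (K2 * (1 + real n) powr - 1)"
        by (intro add_mono 1 mult_left_mono 2) auto
      finally show ?thesis by (simp add: C_def algebra_simps)
    qed
    have "norm (Q powr - (s + 1) * (Pi_term (s + 1) (of_real (odd_pi k) * Q) / of_real (odd_pi k) ^ 2)) \<le>
           C * (1 + real n) powr - 1 * (1 / (odd_pi k)\<^sup>2)" for k
    proof -
      let ?R = "\<lambda>e. Q powr - (s + 1) * ray_Gamma e (odd_pi k) Q (s + 1)"
      have "Q powr - (s + 1) * (Pi_term (s + 1) (of_real (odd_pi k) * Q) / of_real (odd_pi k) ^ 2) =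
         (?R (- 1) + ?R 1) / 2 * (1 / of_real (odd_pi k) ^ 2)"
        unfolding Pi_term_eq_ray_Gamma[OF Q(2) odd_pi_pos(1)] by (simp add: field_simps)
      also have "norm \<dots> = norm (?R (- 1) + ?R 1) / 2 * (1 / (odd_pi k)\<^sup>2)"
        by (simp add: norm_mult norm_divide norm_power)
      also have "\<dots> \<le> (C * (1 + real n) powr - 1 + C * (1 + real n) powr - 1) / 2 * (1 / (odd_pi k)\<^sup>2)"
        by (intro mult_right_mono divide_right_mono norm_triangle_mono r) auto
      also have "\<dots> = C * (1 + real n) powr - 1 * (1 / (odd_pi k)\<^sup>2)" by (simp only: field_sum_of_halves add_divide_distrib)
      finally show ?thesis .
    qed
    note bd = this
    have su: "(\<lambda>k. C * (1 + real n) powr - 1 * (1 / (odd_pi k)\<^sup>2)) sums (C * (1 + real n) powr - 1 * (1 / 8))"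
      by (intro sums_mult odd_pi_inverse_squares_sums)
    have "norm (\<Sum>k. Q powr - (s + 1) * (Pi_term (s + 1) (of_real (odd_pi k) * Q) / of_real (odd_pi k) ^ 2)) \<le>
        C * (1 + real n) powr - 1 * (1 / 8)"
      using norm_suminf_le[OF bd sums_summable[OF su]] sums_unique[OF su] by simp
    also have "(\<Sum>k. Q powr - (s + 1) * (Pi_term (s + 1) (of_real (odd_pi k) * Q) / of_real (odd_pi k) ^ 2)) =
       Q powr (- s - 1) * Pi_series s Q"
      unfolding Pi_series_def using suminf_mult[OF summable_Pi_series[OF Q(1), of s], of "Q powr - (s + 1)"] by simp
    finally have "2 * norm s * norm (Q powr (- s - 1) * Pi_series s Q) \<le> 2 * norm s * (C * (1 + real n) powr - 1 * (1 / 8))"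
      by (intro mult_left_mono) auto
    moreover have "2 * a * (c * X * (1 / 8)) = a * c / 4 * X" for a c X :: real by simp
    then have "2 * norm s * (C * (1 + real n) powr - 1 * (1 / 8)) = norm s * C / 4 * (1 + real n) powr - 1" .
    ultimately show ?thesis by (simp only: norm_mult Q_def norm_numeral mult.assoc)
  qed
  have le: "norm (alt_zeta_rhs s (q + of_nat n)) \<le> K0 * (1 + real n) powr - Re s / 2 + norm s * C / 4 * (1 + real n) powr - 1" for n
  proof -
    have "norm ((q + of_nat n) powr - s / 2) \<le> K0 * (1 + real n) powr - Re s / 2"
      using K0(2)[of "real n"] by (simp add: norm_divide)
    then show ?thesis
      unfolding alt_zeta_rhs_def by (intro norm_triangle_mono Cb)
  qed
  have lim0: "(\<lambda>n. K0 * (1 + real n) powr - Re s / 2 + norm s * C / 4 * (1 + real n) powr - 1) \<longlonglongrightarrow> 0"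
  proof -
    have lim: "(\<lambda>n. (1 + real n) powr - r) \<longlonglongrightarrow> 0" if "r > 0" for r
      using that by real_asymp
    have "(\<lambda>n. K0 * (1 + real n) powr - Re s / 2 + norm s * C / 4 * (1 + real n) powr - 1)
        \<longlonglongrightarrow> K0 * 0 / 2 + norm s * C / 4 * 0"
      by (intro tendsto_add tendsto_mult tendsto_divide tendsto_const lim[OF s] lim) simp_all
    then show ?thesis by simp
  qed
  show ?thesis
    by (rule Lim_null_comparison[OF _ lim0]) (rule always_eventually, rule allI, rule le)
qed

section \<open>Telescoping and identification with the continued zeta function\<close>

lemma alternating_sums_telescope:
  fixes R a :: "nat \<Rightarrow> 'a::real_normed_field"
  assumes R: "\<And>n. R n + R (Suc n) = a n" and lim: "R \<longlonglongrightarrow> 0"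
  shows "(\<lambda>n. (- 1) ^ n * a n) sums R 0"
proof -
  have "(\<Sum>k<n. (- 1) ^ k * a k) = R 0 - (- 1) ^ n * R n" for n
    by (induction n) (simp_all add: algebra_simps flip: R)
  moreover have "(\<lambda>n. (- 1) ^ n * R n) \<longlonglongrightarrow> 0"
    by (rule tendsto_norm_zero_cancel) (use tendsto_norm_zero[OF lim] in \<open>simp add: norm_mult norm_power\<close>)
  then have "(\<lambda>n. R 0 - (- 1) ^ n * R n) \<longlonglongrightarrow> R 0 - 0" by (intro tendsto_intros)
  ultimately show ?thesis by (simp add: sums_def)
qed

lemma alt_hurwitz_zeta_eq:
  assumes q: "q \<notin> \<real>\<^sub>\<le>\<^sub>0"
  shows "alt_hurwitz_zeta s q = alt_zeta_rhs s q"
proof -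
  have q0: "q \<noteq> 0" using q by auto
  let ?P = "\<lambda>f. f holomorphic_on UNIV \<and>
        (\<forall>z. Re z > 0 \<longrightarrow> (\<lambda>n. (-1) ^ n / (of_nat n + q) powr z) sums f z)"
  have hol: "(\<lambda>s. alt_zeta_rhs s q) holomorphic_on UNIV"
    unfolding alt_zeta_rhs_def using q0
    by (intro holomorphic_intros holomorphic_Pi_series[OF q]) auto
  have sums: "(\<lambda>n. (-1) ^ n / (of_nat n + q) powr z) sums alt_zeta_rhs z q" if z: "Re z > 0" for z
  proof -
    have "q + of_nat n \<notin> \<real>\<^sub>\<le>\<^sub>0" for n
      using add_of_real_notin_nonpos_Reals(1)[OF q, of "real n"] by simp
    then have "alt_zeta_rhs z (q + of_nat n) + alt_zeta_rhs z (q + of_nat (Suc n)) = (q + of_nat n) powr - z" for n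
      using alt_zeta_rhs_plus1[of "q + of_nat n" z] z by (simp add: add_ac)
    from alternating_sums_telescope[OF this alt_zeta_rhs_tendsto_0[OF q z]]
    show ?thesis by (simp add: powr_minus field_simps)
  qed
  have "(THE f. ?P f) = (\<lambda>s. alt_zeta_rhs s q)"
  proof (rule the_equality)
    show "?P (\<lambda>s. alt_zeta_rhs s q)" using hol sums by blast
    fix f assume f: "?P f"
    show "f = (\<lambda>s. alt_zeta_rhs s q)"
    proof
      fix z
      show "f z = alt_zeta_rhs z q"
        by (rule analytic_continuation_open[OF open_halfspace_Re_gt[of 0] open_UNIV _ connected_UNIV _ _ hol])
          (use f sums in \<open>auto intro: sums_unique2 exI[of _ 1]\<close>)
    qed
  qed
  then show ?thesis by (simp add: alt_hurwitz_zeta_def)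
qed

text \<open>For fixed k the finite sums are partial sums of a series that diverges factorially
  unless s is a nonpositive integer, so with fast growing N the two series over k can diverge
  separately. The bracket is therefore read as the sum of \<open>A k + B k\<close>, which always
  converges, and the split form is asserted as soon as one of the two series converges.\<close>

theorem theorem3p18:
  fixes s q :: complex and N :: "nat \<Rightarrow> nat"
  assumes "\<And>k. N k > 0"
    and "\<And>k. Re s > - 2 * real (N k)"
    and "q \<noteq> 0"
    and "\<bar>Arg q\<bar> < pi"
  shows "let w = (\<lambda>k::nat. of_nat (2 * k + 1) * of_real pi :: complex);
             A = (\<lambda>k. \<Sum>n = 1..N k - 1. (-1) ^ (n - 1) *
                    (pochhammer s (2 * n + 1) / (w k ^ (2 * n + 2) * q ^ (2 * n + 1))));
             B = (\<lambda>k. (-1) ^ (N k - 1) *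
                    (pochhammer s (2 * N k + 1) * Pi_term (s + of_nat (2 * N k + 1)) (w k * q)
                      / (w k ^ (2 * N k + 2) * q ^ (2 * N k + 1))))
         in summable (\<lambda>k. A k + B k) \<and>
            alt_hurwitz_zeta s q = 1 / 2 * q powr (- s) + 1 / 4 * s * q powr (- s - 1)
              - 2 * q powr (- s) * (\<Sum>k. A k + B k) \<and>
            (summable A \<or> summable B \<longrightarrow>
               summable A \<and> summable B \<and>
               alt_hurwitz_zeta s q = 1 / 2 * q powr (- s) + 1 / 4 * s * q powr (- s - 1)
                 - 2 * q powr (- s) * ((\<Sum>k. A k) + (\<Sum>k. B k)))"
proof -
  define w where "w = (\<lambda>k::nat. of_nat (2 * k + 1) * of_real pi :: complex)"
  define A where "A = (\<lambda>k. \<Sum>n = 1..N k - 1. (-1) ^ (n - 1) *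
                    (pochhammer s (2 * n + 1) / (w k ^ (2 * n + 2) * q ^ (2 * n + 1))))"
  define B where "B = (\<lambda>k. (-1) ^ (N k - 1) *
                    (pochhammer s (2 * N k + 1) * Pi_term (s + of_nat (2 * N k + 1)) (w k * q)
                      / (w k ^ (2 * N k + 2) * q ^ (2 * N k + 1))))"
  have q: "q \<notin> \<real>\<^sub>\<le>\<^sub>0"
  proof
    assume "q \<in> \<real>\<^sub>\<le>\<^sub>0"
    with \<open>q \<noteq> 0\<close> have "Re q < 0" "Im q = 0" by (auto simp: complex_nonpos_Reals_iff complex_eq_iff less_le)
    then have "Arg q = pi" using Arg_eq_pi by blast
    with \<open>\<bar>Arg q\<bar> < pi\<close> show False by simp
  qed
  have w: "w k = of_real (odd_pi k)" for k by (simp add: w_def odd_pi_def)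
  have w0: "w k \<noteq> 0" for k by (simp add: w)
  have "A k + B k = s / q * (1 / of_real (odd_pi k) ^ 2 - Pi_term (s + 1) (of_real (odd_pi k) * q) / of_real (odd_pi k) ^ 2)" for k
  proof -
    have "A k + B k = s / ((w k)\<^sup>2 * q) * (1 - Pi_term (s + 1) (w k * q))"
      unfolding A_def B_def by (rule expansion_term_eq[OF w0 \<open>q \<noteq> 0\<close> assms(1)])
    then show ?thesis by (simp add: w field_simps)
  qed
  moreover have "(\<lambda>k. s / q * (1 / of_real (odd_pi k) ^ 2 - Pi_term (s + 1) (of_real (odd_pi k) * q) / of_real (odd_pi k) ^ 2))
      sums (s / q * (1 / 8 - Pi_series s q))"
  proof (intro sums_mult sums_diff)
    show "(\<lambda>k. 1 / of_real (odd_pi k) ^ 2 :: complex) sums (1 / 8)"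
      using odd_inverse_squares_sums unfolding odd_pi_def .
    show "(\<lambda>k. Pi_term (s + 1) (of_real (odd_pi k) * q) / of_real (odd_pi k) ^ 2) sums Pi_series s q"
      unfolding Pi_series_def by (rule summable_sums[OF summable_Pi_series[OF q]])
  qed
  ultimately have sums: "(\<lambda>k. A k + B k) sums (s / q * (1 / 8 - Pi_series s q))" by simp
  have 1: "summable (\<lambda>k. A k + B k)" using sums by (rule sums_summable)
  have "q powr (- s) / q = q powr (- s - 1)" using \<open>q \<noteq> 0\<close> by (simp add: powr_diff)
  \<comment> \<open>The part 1/8 of the sum, multiplied by -2 q^(-s) s / q, cancels the explicit
    term s q^(-s-1) / 4.\<close>
  then have 2: "alt_hurwitz_zeta s q = 1 / 2 * q powr (- s) + 1 / 4 * s * q powr (- s - 1)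
              - 2 * q powr (- s) * (\<Sum>k. A k + B k)"
    using \<open>q \<noteq> 0\<close> unfolding alt_hurwitz_zeta_eq[OF q] alt_zeta_rhs_def sums_unique[OF sums, symmetric]
    by (simp add: field_simps)
  \<comment> \<open>Subtracting a convergent series from the convergent total leaves a convergent
    one.\<close>
  have 3: "summable A \<and> summable B \<and> (\<Sum>k. A k + B k) = (\<Sum>k. A k) + (\<Sum>k. B k)" if "summable A \<or> summable B"
  proof -
    have "summable A \<and> summable B"
      using that summable_diff[OF 1, of A] summable_diff[OF 1, of B] by auto
    then show ?thesis by (simp add: suminf_add)
  qed
  have 4: "summable A \<and> summable B \<and>
               alt_hurwitz_zeta s q = 1 / 2 * q powr (- s) + 1 / 4 * s * q powr (- s - 1)
                 - 2 * q powr (- s) * ((\<Sum>k. A k) + (\<Sum>k. B k))" if "summable A \<or> summable B"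
    using 2 3[OF that] by simp
  from 1 2 4 show ?thesis
    unfolding Let_def A_def B_def w_def by blast
qed

end
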